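(* Consider the two-stage multinomial model described in the context, in which the first-stage model is a full model and the first-stage parameter $\tau$ is completely known (equivalently, $m_{1\cdot},\ldots,m_{I\cdot}$ are all known), so that the MLE is $\widehat m_{ij}=m_{i\cdot}\,\widehat p_{ij}$ for $1\le i\le I$, $1\le j\le J_i$. Then, as $n\to\infty$, the risk of the MLE satisfies $$ED[\widehat{m}:m]=\frac{1}{2n}\sum_{i=1}^I s_i+\frac{1}{24n^2}\sum_{i=1}^I m_{i\cdot}^{-1}\Bigl(A_{(i)}+12(1-m_{i\cdot})s_i\Bigr)+o(n^{-2}).$$ In particular, if all the second-stage models are full models, then, with $p'=I-1+\sum_{i=1}^I s_i$ (where now $s_i=J_i-1$), $$ED[\widehat{m}:m]=\frac{p'-(I-1)}{2n}+\frac{1}{12n^2}\Bigl(\sum_{i=1}^I\sum_{j=1}^{J_i}m_{ij}^{-1}+\sum_{i=1}^I m_{i\cdot}^{-1}(6J_i-7)-6(p'+1-I)\Bigr)+o(n^{-2}).$$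
   Context: Two-stage multinomial model. Let $I\ge 2$ and $J_1,\ldots,J_I\ge 1$ be integers. In each of $n$ independent trials a random variable falls in exactly one of the categories $C_{ij}$ ($1\le i\le I$, $1\le j\le J_i$), with true probabilities $m_{ij}>0$, $\sum_{i,j}m_{ij}=1$. Put $m_{i\cdot}=\sum_{j=1}^{J_i}m_{ij}$ and $p_{ij}=m_{ij}/m_{i\cdot}$. Let $X_{ij}$ be the number of trials falling in $C_{ij}$ and $X_{i\cdot}=\sum_{j=1}^{J_i}X_{ij}$. The first-stage model is the model for $m_f=(m_{1\cdot},\ldots,m_{I\cdot})$, which depends on a parameter $\tau$. For each $i$, the $i$-th second-stage model is the model for $p_i=(p_{i1},\ldots,p_{iJ_i})$, which depends on an $s_i$-dimensional parameter $\theta^{(i)}=(\theta^{(i)}_1,\ldots,\theta^{(i)}_{s_i})$. The parameters $\tau,\theta^{(1)},\ldots,\theta^{(I)}$ vary independently, and the true distribution belongs to the model. A (first- or second-stage) model is called full if its probability vector is subject to no restriction other than being a probability vector; thus a full second-stage model has $s_i=J_i-1$. The estimator $\widehat p_i=(\widehat p_{i1},\ldots,\widehat p_{iJ_i})$ is the maximum likelihood estimator in the $i$-th second-stage model based on the counts $X_{i1},\ldots,X_{iJ_i}$ (given $X_{i\cdot}$, these are multinomial with sample size $X_{i\cdot}$ and probabilities $p_i$). For probability vectors $q,r$ on the same finite index set, $D[q:r]=\sum_k q_k\log(q_k/r_k)$ is the Kullback--Leibler divergence, with $0\log 0=0$. The risk of an estimator $\widehat m$ of $m=(m_{ij})$ is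 $ED[\widehat m:m]=E\bigl[D[\widehat m:m]\bigr]$, where $E$ is the expectation under the true distribution. Samples with $X_{i\cdot}=0$ for some $i$ are discarded, i.e. this expectation is taken conditionally on $X_{i\cdot}\ne 0$ for all $1\le i\le I$. The quantity $A_{(i)}=A_{(i)}(p_i)$ is defined by the asymptotic expansion of the risk of the MLE in the $i$-th second-stage model: when the $i$-th second-stage model alone is sampled with sample size $n$ (i.e. the counts are multinomial with sample size $n$ and probabilities $p_i$), $$E\bigl[D[\widehat p_i:p_i]\bigr]=\frac{s_i}{2n}+\frac{1}{24n^2}A_{(i)}(p_i)+o(n^{-2})\qquad(n\to\infty).$$ It is a standing assumption that the MLEs exist and that this expansion holds for each $i$. *)

theory Defs
  imports "HOL-Probability.Probability" "HOL-Library.Landau_Symbols"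
begin

text \<open>Vectors indexed by a finite set \<open>K\<close> are functions vanishing outside \<open>K\<close>, so that equality of
  vectors is equality of functions. The cells are the pairs \<open>(i, j)\<close> with \<open>1 \<le> i \<le> I\<close> and
  \<open>1 \<le> j \<le> J i\<close>.\<close>

definition prob_vectors :: "'k set \<Rightarrow> ('k \<Rightarrow> real) set" where
  "prob_vectors K = {q. (\<forall>k. 0 \<le> q k) \<and> (\<forall>k. k \<notin> K \<longrightarrow> q k = 0) \<and> sum q K = 1}"

definition count_vectors :: "'k set \<Rightarrow> ('k \<Rightarrow> nat) set" where
  "count_vectors K = {x. \<forall>k. k \<notin> K \<longrightarrow> x k = 0}"

text \<open>Joint law of the category counts in \<open>n\<close> independent trials, each with category probabilities
  \<open>q\<close>. Meaningful for \<open>q \<in> prob_vectors K\<close> with \<open>K\<close> finite.\<close>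

definition multinomial_pmf :: "nat \<Rightarrow> ('k \<Rightarrow> real) \<Rightarrow> ('k \<Rightarrow> nat) pmf" where
  "multinomial_pmf n q = map_pmf count_list (replicate_pmf n (embed_pmf q))"

definition likelihood :: "'k set \<Rightarrow> ('k \<Rightarrow> nat) \<Rightarrow> ('k \<Rightarrow> real) \<Rightarrow> real" where
  "likelihood K x q = pmf (multinomial_pmf (sum x K) q) x"

definition is_mle :: "'k set \<Rightarrow> ('k \<Rightarrow> real) set \<Rightarrow> ('k \<Rightarrow> nat) \<Rightarrow> ('k \<Rightarrow> real) \<Rightarrow> bool" where
  "is_mle K M x q \<longleftrightarrow> q \<in> M \<and> (\<forall>r\<in>M. likelihood K x r \<le> likelihood K x q)"

text \<open>The convention \<open>0 log 0 = 0\<close> is automatic, since \<open>0 * ln 0 = 0\<close>.\<close>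

definition KL :: "'k set \<Rightarrow> ('k \<Rightarrow> real) \<Rightarrow> ('k \<Rightarrow> real) \<Rightarrow> real" where
  "KL K q r = (\<Sum>k\<in>K. q k * ln (q k / r k))"

definition cells :: "nat \<Rightarrow> (nat \<Rightarrow> nat) \<Rightarrow> (nat \<times> nat) set" where
  "cells I J = (SIGMA i:{1..I}. {1..J i})"

definition row_sum :: "(nat \<Rightarrow> nat) \<Rightarrow> (nat \<times> nat \<Rightarrow> 'a::comm_monoid_add) \<Rightarrow> nat \<Rightarrow> 'a" where
  "row_sum J v i = (\<Sum>j=1..J i. v (i, j))"

definition cond_probs :: "(nat \<Rightarrow> nat) \<Rightarrow> (nat \<times> nat \<Rightarrow> real) \<Rightarrow> nat \<Rightarrow> nat \<Rightarrow> real" where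
  "cond_probs J m i = (\<lambda>j. m (i, j) / row_sum J m i)"

text \<open>\<open>F\<close> is the set of admissible first-stage vectors, \<open>S i\<close> that of the \<open>i\<close>-th second-stage
  vectors; they are combined freely because the parameters of the stages vary independently.\<close>

definition two_stage_model ::
  "nat \<Rightarrow> (nat \<Rightarrow> real) set \<Rightarrow> (nat \<Rightarrow> (nat \<Rightarrow> real) set) \<Rightarrow> (nat \<times> nat \<Rightarrow> real) set" where
  "two_stage_model I F S =
     {(\<lambda>(i, j). f i * q i j) | f q. f \<in> F \<and> (\<forall>i\<in>{1..I}. q i \<in> S i)}"

definition second_stage_risk ::
  "nat \<Rightarrow> ((nat \<Rightarrow> nat) \<Rightarrow> nat \<Rightarrow> real) \<Rightarrow> (nat \<Rightarrow> real) \<Rightarrow> nat \<Rightarrow> real" where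
  "second_stage_risk Ji est p n =
     measure_pmf.expectation (multinomial_pmf n p) (\<lambda>x. KL {1..Ji} (est x) p)"

definition known_first_stage_estimator ::
  "(nat \<Rightarrow> nat) \<Rightarrow> (nat \<times> nat \<Rightarrow> real) \<Rightarrow> (nat \<Rightarrow> (nat \<Rightarrow> nat) \<Rightarrow> nat \<Rightarrow> real) \<Rightarrow>
     (nat \<times> nat \<Rightarrow> nat) \<Rightarrow> nat \<times> nat \<Rightarrow> real" where
  "known_first_stage_estimator J m phat X =
     (\<lambda>(i, j). row_sum J m i * phat i (\<lambda>j'. X (i, j')) j)"

definition nonempty_rows :: "nat \<Rightarrow> (nat \<Rightarrow> nat) \<Rightarrow> (nat \<times> nat \<Rightarrow> nat) set" where
  "nonempty_rows I J = {X. \<forall>i\<in>{1..I}. row_sum J X i \<noteq> 0}"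

text \<open>For \<open>n < I\<close> the conditioning event is null and the value is meaningless; only the behaviour
  for large \<open>n\<close> matters.\<close>

definition two_stage_risk ::
  "nat \<Rightarrow> (nat \<Rightarrow> nat) \<Rightarrow> ((nat \<times> nat \<Rightarrow> nat) \<Rightarrow> nat \<times> nat \<Rightarrow> real) \<Rightarrow>
     (nat \<times> nat \<Rightarrow> real) \<Rightarrow> nat \<Rightarrow> real" where
  "two_stage_risk I J est m n =
     measure_pmf.expectation (cond_pmf (multinomial_pmf n m) (nonempty_rows I J))
       (\<lambda>X. KL (cells I J) (est X) m)"

end

theory Submission
  imports Defs "HOL-Real_Asymp.Real_Asymp"
begin

text \<open>With known first stage the loss is the sum over \<open>i\<close> of \<open>m\<^sub>i\<close> times the loss of the \<open>i\<close>-th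
  second-stage estimator, and row \<open>i\<close> of the table is multinomial with a \<open>Bin(n, m\<^sub>i)\<close> distributed
  sample size. Conditioning on nonempty rows costs only an exponentially small error, so the risk is
  the sum of \<open>m\<^sub>i E[R\<^sub>i(N)]\<close> with \<open>N\<close> binomial and \<open>R\<^sub>i\<close> the second-stage risk. Its expansion follows
  by comparing \<open>1/k\<close> and \<open>1/k\<^sup>2\<close> with \<open>1/(k+1)\<close>, \<open>1/((k+1)(k+2))\<close> and \<open>1/((k+1)(k+2)(k+3))\<close>, whose
  binomial expectations are explicit by size biasing. For full second-stage models the MLE is the
  vector of relative frequencies; expanding \<open>x ln x\<close> to fourth order around the mean gives its risk
  up to \<open>o(n\<^sup>-\<^sup>2)\<close>, which determines \<open>s\<^sub>i\<close> and \<open>A\<^sub>i\<close> by uniqueness of asymptotic expansions.\<close>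

section \<open>Multinomial distributions and maximum likelihood\<close>

text \<open>The sample size of a row is random and may vanish, which causes two difficulties.
  Nothing is known about \<open>phat i\<close> on an empty row, so the loss there is replaced by 0
  when the conditioning is removed; all remaining losses lie below a constant independent of the
  sample and of \<open>n\<close>. Moreover, the assumed expansion of the second-stage risk concerns
  large sample sizes only, while the binomial mean runs over all of them; the shifted weights are
  finite and positive at \<open>k = 0\<close> too, so that error terms can be dominated at every
  \<open>k\<close>. Rows of the table are dependent, but the loss is additive over rows and, for
  relative frequencies, over categories. By linearity of expectation only one-dimensional binomial
  laws remain. The contribution \<open>12 * (1 - row_sum J m i) * real (s i)\<close> comes from the
  randomness of the row total: the mean of \<open>1 / k\<close> exceeds \<open>1 / (n p)\<close> by
  \<open>(1 - p) / (n p)^2\<close> to second order. For relative frequencies the Taylor remainder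
  must also be controlled far from the mean. This is why a sixth central moment appears beside the
  first four.\<close>

lemma pmf_embed_prob_vector:
  assumes "finite K" "q \<in> prob_vectors K"
  shows "pmf (embed_pmf q) k = q k"
proof (rule pmf_embed_pmf)
  show "0 \<le> q x" for x using assms by (auto simp: prob_vectors_def)
  have "(\<integral>\<^sup>+ x. ennreal (q x) \<partial>count_space UNIV) = (\<Sum>x\<in>K. ennreal (q x))"
    using assms by (intro nn_integral_count_space'[of K]) (auto simp: prob_vectors_def)
  also have "\<dots> = 1" using assms by (subst sum_ennreal) (auto simp: prob_vectors_def)
  finally show "(\<integral>\<^sup>+ x. ennreal (q x) \<partial>count_space UNIV) = 1" .
qed

lemma set_pmf_embed_prob_vector:
  assumes "finite K" "q \<in> prob_vectors K"
  shows "set_pmf (embed_pmf q) \<subseteq> K"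
  using assms by (auto simp: set_pmf_eq pmf_embed_prob_vector prob_vectors_def)

lemma measure_embed_prob_vector:
  assumes "finite K" "q \<in> prob_vectors K"
  shows "measure_pmf.prob (embed_pmf q) A = sum q (A \<inter> K)"
proof -
  have "measure_pmf.prob (embed_pmf q) A = measure_pmf.prob (embed_pmf q) (A \<inter> K)"
    using set_pmf_embed_prob_vector[OF assms]
    by (intro measure_pmf.finite_measure_eq_AE) (auto simp: AE_measure_pmf_iff)
  also have "\<dots> = sum q (A \<inter> K)"
    using assms by (simp add: measure_measure_pmf_finite pmf_embed_prob_vector)
  finally show ?thesis .
qed

lemma multinomial_pmf_0: "multinomial_pmf 0 q = return_pmf (\<lambda>_. 0)"
  by (simp add: multinomial_pmf_def fun_eq_iff)

text \<open>Splits off the first trial. This recursion drives the inductions on \<open>n\<close>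
  that identify the margins and rows of a multinomial table.\<close>

lemma multinomial_pmf_Suc:
  "multinomial_pmf (Suc n) q =
    embed_pmf q \<bind> (\<lambda>c. map_pmf (\<lambda>x. x(c := Suc (x c))) (multinomial_pmf n q))"
proof -
  have "count_list (c # l) = (count_list l)(c := Suc (count_list l c))" for c :: 'a and l
    by (auto simp: fun_eq_iff)
  then show ?thesis
    by (simp add: multinomial_pmf_def map_bind_pmf map_pmf_comp map_pmf_def[symmetric] del: count_list.simps)
qed

lemma set_pmf_multinomial_subset:
  assumes "finite K" "q \<in> prob_vectors K"
  shows "set_pmf (multinomial_pmf n q) \<subseteq> {x \<in> count_vectors K. sum x K = n}"
proof
  fix x assume "x \<in> set_pmf (multinomial_pmf n q)"
  then obtain l where l: "set l \<subseteq> K" "length l = n" "x = count_list l"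
    using set_pmf_embed_prob_vector[OF assms]
    by (auto simp: multinomial_pmf_def set_replicate_pmf lists_eq_set)
  then show "x \<in> {x \<in> count_vectors K. sum x K = n}"
    using assms sum_count_set[of l K] by (auto simp: count_vectors_def count_list_0_iff)
qed

text \<open>Finite support makes every loss integrable, so expectations can be split without further
  conditions.\<close>

lemma finite_set_pmf_multinomial:
  assumes "finite K" "q \<in> prob_vectors K"
  shows "finite (set_pmf (multinomial_pmf n q))"
proof -
  have "set_pmf (replicate_pmf n (embed_pmf q)) \<subseteq> {l. set l \<subseteq> K \<and> length l = n}"
    using set_pmf_embed_prob_vector[OF assms] by (auto simp: set_replicate_pmf lists_eq_set)
  then show ?thesis
    using finite_lists_length_eq[OF assms(1), of n]
    by (auto simp: multinomial_pmf_def intro: finite_subset)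
qed

section \<open>Likelihoods and their maximisers\<close>

lemma pmf_replicate_pmf: "pmf (replicate_pmf (length l) D) l = prod_list (map (pmf D) l)"
proof (induction l)
  case (Cons y l)
  have "replicate_pmf (length (y # l)) D =
      map_pmf (\<lambda>(x, xs). x # xs) (pair_pmf D (replicate_pmf (length l) D))"
    by (simp add: pair_pmf_def map_bind_pmf)
  moreover have "pmf (map_pmf (\<lambda>(x, xs). x # xs) (pair_pmf D (replicate_pmf (length l) D)))
      ((\<lambda>(x, xs). x # xs) (y, l)) = pmf (pair_pmf D (replicate_pmf (length l) D)) (y, l)"
    by (rule pmf_map_inj') (auto simp: inj_def)
  ultimately show ?case using Cons by (simp add: pmf_pair)
qed simp

lemma prod_list_eq_prod_count_list:
  fixes f :: "'k \<Rightarrow> real"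
  assumes "finite K" "set l \<subseteq> K"
  shows "prod_list (map f l) = (\<Prod>k\<in>K. f k ^ count_list l k)"
  using assms(2)
proof (induction l)
  case (Cons y l)
  have "(\<Prod>k\<in>K. f k ^ count_list (y # l) k) = (\<Prod>k\<in>K. (if k = y then f k else 1) * f k ^ count_list l k)"
    by (rule prod.cong) auto
  also have "\<dots> = f y * (\<Prod>k\<in>K. f k ^ count_list l k)"
    using assms(1) Cons.prems by (simp add: prod.distrib prod.delta)
  finally show ?case using Cons by simp
qed simp

text \<open>The number of lists with count vector \<open>x\<close> is the multinomial coefficient.
  Later steps need only that it is finite and positive, so it is never computed.\<close>

lemma count_list_eq_count_vector:
  assumes "finite K" "x \<in> count_vectors K"
  shows "finite {l. count_list l = x}" "{l. count_list l = x} \<noteq> {}"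
    "\<And>l. count_list l = x \<Longrightarrow> set l \<subseteq> K \<and> length l = sum x K"
proof -
  show *: "set l \<subseteq> K \<and> length l = sum x K" if "count_list l = x" for l
  proof -
    have "set l \<subseteq> K"
    proof
      fix k assume "k \<in> set l"
      then have "x k \<noteq> 0" using that count_list_0_iff[of l k] by auto
      then show "k \<in> K" using assms by (auto simp: count_vectors_def)
    qed
    then show ?thesis using sum_count_set[of l K] assms that by auto
  qed
  have "{l. count_list l = x} \<subseteq> {l. set l \<subseteq> K \<and> length l = sum x K}" using * by auto
  then show "finite {l. count_list l = x}"
    using finite_lists_length_eq[OF assms(1)] by (rule finite_subset)
  obtain ks where ks: "set ks = K" "distinct ks" using finite_distinct_list[OF assms(1)] by auto
  \<comment> \<open>The witness lists every category \<open>k\<close> exactly \<open>x k\<close>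
    times. The claim is stated for all distinct lists \<open>ls\<close> so that induction
    applies.\<close>
  have "count_list (concat (map (\<lambda>k. replicate (x k) k) ls)) j = (if j \<in> set ls then x j else 0)"
    if "distinct ls" for ls j
  proof -
    have rep: "count_list (replicate n k) j = (if k = j then n else 0)" for n and k :: 'a
      by (induction n) auto
    show ?thesis using that by (induction ls) (auto simp: rep)
  qed
  from this[OF ks(2)] have "count_list (concat (map (\<lambda>k. replicate (x k) k) ks)) = x"
    using assms ks by (auto simp: fun_eq_iff count_vectors_def)
  then show "{l. count_list l = x} \<noteq> {}" by blast
qed

text \<open>All samples with the same counts are equally likely, because the product of the trial
  probabilities depends on the sample only through its counts.\<close>

lemma likelihood_eq:
  assumes "finite K" "q \<in> prob_vectors K" "x \<in> count_vectors K"
  shows "likelihood K x q = real (card {l. count_list l = x}) * (\<Prod>k\<in>K. q k ^ x k)"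
proof -
  let ?S = "{l. count_list l = x}"
  note S = count_list_eq_count_vector[OF assms(1,3)]
  have "likelihood K x q = measure_pmf.prob (replicate_pmf (sum x K) (embed_pmf q)) ?S"
    by (simp add: likelihood_def multinomial_pmf_def pmf_map vimage_def)
  also have "\<dots> = (\<Sum>l\<in>?S. pmf (replicate_pmf (sum x K) (embed_pmf q)) l)"
    using S(1) by (rule measure_measure_pmf_finite)
  also have "\<dots> = (\<Sum>l\<in>?S. \<Prod>k\<in>K. q k ^ x k)"
  proof (rule sum.cong)
    fix l assume "l \<in> ?S"
    then have l: "count_list l = x" "set l \<subseteq> K" "length l = sum x K" using S(3)[of l] by auto
    have "pmf (replicate_pmf (sum x K) (embed_pmf q)) l = prod_list (map (pmf (embed_pmf q)) l)"
      using pmf_replicate_pmf[of l] l by simp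
    also have "\<dots> = (\<Prod>k\<in>K. q k ^ x k)"
      using prod_list_eq_prod_count_list[OF assms(1) l(2)] l(1) assms by (simp add: pmf_embed_prob_vector)
    finally show "pmf (replicate_pmf (sum x K) (embed_pmf q)) l = (\<Prod>k\<in>K. q k ^ x k)" .
  qed simp
  finally show ?thesis by simp
qed

text \<open>The multinomial coefficient is positive and does not depend on the parameter, so
  maximising the likelihood means maximising the monomial.\<close>

lemma is_mle_iff:
  assumes "finite K" "M \<subseteq> prob_vectors K" "x \<in> count_vectors K"
  shows "is_mle K M x q \<longleftrightarrow> q \<in> M \<and> (\<forall>r\<in>M. (\<Prod>k\<in>K. r k ^ x k) \<le> (\<Prod>k\<in>K. q k ^ x k))"
proof -
  have "0 < card {l. count_list l = x}"
    using count_list_eq_count_vector[OF assms(1,3)] by (simp add: card_gt_0_iff)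
  moreover have "likelihood K x r = real (card {l. count_list l = x}) * (\<Prod>k\<in>K. r k ^ x k)" if "r \<in> M" for r
    using that assms by (intro likelihood_eq) auto
  ultimately show ?thesis unfolding is_mle_def by auto
qed

text \<open>Gibbs' inequality with its equality case, restricted to the cells with positive count.\<close>

lemma is_mle_full_model:
  assumes K: "finite K" and x: "x \<in> count_vectors K" "sum x K \<noteq> 0"
    and mle: "is_mle K (prob_vectors K) x q"
  shows "q = (\<lambda>k. real (x k) / real (sum x K))"
proof -
  let ?N = "real (sum x K)"
  define f where "f k = real (x k) / ?N" for k
  have N: "?N > 0" using x(2) by (simp only: of_nat_0_less_iff neq0_conv)
  have f: "f \<in> prob_vectors K"
    using x N by (auto simp: prob_vectors_def f_def count_vectors_def sum_divide_distrib[symmetric])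
  have q: "q \<in> prob_vectors K" and le: "(\<Prod>k\<in>K. f k ^ x k) \<le> (\<Prod>k\<in>K. q k ^ x k)"
    using mle f is_mle_iff[OF K order_refl x(1)] by auto
  \<comment> \<open>Logarithms are taken only on the cells that were hit. There \<open>q\<close> is
    positive, since its likelihood is at least that of \<open>f\<close>, which is positive.\<close>
  define S where "S = {k\<in>K. x k \<noteq> 0}"
  have S: "finite S" "S \<subseteq> K" "\<And>k. k \<in> S \<Longrightarrow> f k > 0" using K N by (auto simp: S_def f_def)
  have prodS: "(\<Prod>k\<in>K. r k ^ x k) = (\<Prod>k\<in>S. r k ^ x k)" for r :: "'a \<Rightarrow> real"
    using K by (intro prod.mono_neutral_right) (auto simp: S_def)
  have pf: "0 < (\<Prod>k\<in>S. f k ^ x k)" using S by (intro prod_pos) auto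
  with le have pq: "(\<Prod>k\<in>S. q k ^ x k) > 0" unfolding prodS by linarith
  have qpos: "q k > 0" if "k \<in> S" for k
  proof -
    have "q k \<noteq> 0"
    proof
      assume "q k = 0"
      then have "(\<Prod>k\<in>S. q k ^ x k) = 0" using that S(1) by (auto intro!: prod_zero simp: S_def)
      with pq show False by simp
    qed
    then show ?thesis using q by (auto simp: prob_vectors_def less_le)
  qed
  have lnprod: "ln (\<Prod>k\<in>S. r k ^ x k) = (\<Sum>k\<in>S. real (x k) * ln (r k))"
    if pos: "\<And>k. k \<in> S \<Longrightarrow> r k > 0" for r
    using S(1) by (subst ln_prod) (auto simp: ln_realpow dest: pos)
  have le_ln: "(\<Sum>k\<in>S. real (x k) * ln (f k)) \<le> (\<Sum>k\<in>S. real (x k) * ln (q k))"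
  proof -
    have "ln (\<Prod>k\<in>S. f k ^ x k) \<le> ln (\<Prod>k\<in>S. q k ^ x k)"
      using le pf pq unfolding prodS by (subst ln_le_cancel_iff)
    then show ?thesis by (simp only: lnprod S(3) qpos)
  qed
  have 1: "0 \<le> (\<Sum>k\<in>S. real (x k) * ln (q k / f k))"
  proof -
    have "(\<Sum>k\<in>S. real (x k) * ln (q k / f k)) = (\<Sum>k\<in>S. real (x k) * ln (q k) - real (x k) * ln (f k))"
    proof (rule sum.cong)
      fix k assume "k \<in> S"
      then show "real (x k) * ln (q k / f k) = real (x k) * ln (q k) - real (x k) * ln (f k)"
        using S(3)[of k] qpos[of k] by (simp add: ln_div right_diff_distrib)
    qed simp
    with le_ln show ?thesis by (simp add: sum_subtractf)
  qed
  have term_le: "real (x k) * ln (q k / f k) \<le> ?N * q k - real (x k)" if "k \<in> S" for k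
  proof -
    have "real (x k) * ln (q k / f k) \<le> real (x k) * (q k / f k - 1)"
      using S(3)[OF that] qpos[OF that] by (intro mult_left_mono ln_le_minus_one) auto
    also have "\<dots> = ?N * q k - real (x k)"
      using that N by (simp add: f_def S_def field_simps)
    finally show ?thesis .
  qed
  have xS: "(\<Sum>k\<in>S. real (x k)) = ?N"
  proof -
    have "sum x S = sum x K" using K by (intro sum.mono_neutral_left) (auto simp: S_def)
    then show ?thesis by (metis of_nat_sum)
  qed
  have qS: "sum q S \<le> 1"
    using sum_mono2[of K S q] K S q by (auto simp: prob_vectors_def)
  have rhs: "(\<Sum>k\<in>S. ?N * q k - real (x k)) = ?N * (sum q S - 1)"
    by (simp add: sum_subtractf xS sum_distrib_left[symmetric] right_diff_distrib)
  have "?N * (sum q S - 1) \<le> 0" using N qS by (simp add: mult_le_0_iff)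
  moreover have "(\<Sum>k\<in>S. real (x k) * ln (q k / f k)) \<le> (\<Sum>k\<in>S. ?N * q k - real (x k))"
    by (rule sum_mono) (fact term_le)
  \<comment> \<open>The sum is squeezed: it is at least 0 by maximality of \<open>q\<close> against
    \<open>f\<close>, and at most \<open>?N * (sum q S - 1) \<le> 0\<close>. Both bounds being 0
    forces equality in every termwise inequality \<open>ln t \<le> t - 1\<close> and leaves
    \<open>q\<close> no mass outside \<open>S\<close>.\<close>
  ultimately have sum0: "(\<Sum>k\<in>S. real (x k) * ln (q k / f k)) = 0" "?N * (sum q S - 1) = 0"
    using 1 rhs by linarith+
  have "(\<Sum>k\<in>S. (?N * q k - real (x k)) - real (x k) * ln (q k / f k)) = 0"
    using sum0 rhs by (simp add: sum_subtractf)
  then have eq: "\<forall>k\<in>S. (?N * q k - real (x k)) - real (x k) * ln (q k / f k) = 0"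
    using S(1) term_le by (subst (asm) sum_nonneg_eq_0_iff) auto
  have qfS: "q k = f k" if "k \<in> S" for k
  proof -
    have "?N * q k - real (x k) = real (x k) * (q k / f k - 1)"
      using that N by (simp add: f_def S_def field_simps)
    with bspec[OF eq that] have "real (x k) * (q k / f k - 1) = real (x k) * ln (q k / f k)" by linarith
    then have "ln (q k / f k) = q k / f k - 1" using that by (simp add: S_def)
    then have "q k / f k = 1" using S(3)[OF that] qpos[OF that] by (intro ln_eq_minus_one) auto
    then show ?thesis using S(3)[OF that] by simp
  qed
  have "sum q (K - S) = 0"
    using sum0(2) N q S(2) K by (simp add: sum_diff prob_vectors_def)
  then have q0: "\<forall>k\<in>K - S. q k = 0"
    using K q by (subst (asm) sum_nonneg_eq_0_iff) (auto simp: prob_vectors_def)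
  show ?thesis
  proof
    fix k
    show "q k = real (x k) / ?N"
    proof (cases "k \<in> S")
      case True
      then show ?thesis using qfS by (simp add: f_def)
    next
      case False
      then have "x k = 0" using x(1) by (auto simp: S_def count_vectors_def)
      moreover have "q k = 0" using False q0 q by (cases "k \<in> K") (auto simp: prob_vectors_def)
      ultimately show ?thesis by simp
    qed
  qed
qed

section \<open>Margins and rows of multinomial tables\<close>

lemma multinomial_sum_binomial:
  assumes K: "finite K" "q \<in> prob_vectors K" "A \<subseteq> K"
  shows "map_pmf (\<lambda>x. sum x A) (multinomial_pmf n q) = binomial_pmf n (sum q A)"
proof -
  have fA: "finite A" using K finite_subset by blast
  have "sum q A \<le> sum q K" using K by (intro sum_mono2) (auto simp: prob_vectors_def)
  then have p: "sum q A \<in> {0..1}" using K by (auto simp: prob_vectors_def intro: sum_nonneg)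
  \<comment> \<open>A trial matters only through whether it falls in \<open>A\<close>, so each step
    of the induction adds an independent Bernoulli variable.\<close>
  have B: "map_pmf (\<lambda>c. c \<in> A) (embed_pmf q) = bernoulli_pmf (sum q A)"
  proof (rule pmf_eqI)
    fix b
    have "A \<inter> K = A" "- A \<inter> K = K - A" using K by auto
    then have "pmf (map_pmf (\<lambda>c. c \<in> A) (embed_pmf q)) b = (if b then sum q A else sum q (K - A))"
      using measure_embed_prob_vector[OF K(1,2), of A] measure_embed_prob_vector[OF K(1,2), of "-A"]
      by (cases b) (simp_all add: pmf_map vimage_def Compl_eq)
    then show "pmf (map_pmf (\<lambda>c. c \<in> A) (embed_pmf q)) b = pmf (bernoulli_pmf (sum q A)) b"
      using p K by (cases b) (auto simp: sum_diff prob_vectors_def)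
  qed
  show ?thesis
  proof (induction n)
    case 0
    then show ?case using p by (simp add: multinomial_pmf_0 binomial_pmf_0)
  next
    case (Suc n)
    have upd: "sum (x(c := Suc (x c))) A = (if c \<in> A then 1 else 0) + sum x A" for x :: "'a \<Rightarrow> nat" and c
    proof -
      have "sum (x(c := Suc (x c))) A = (\<Sum>k\<in>A. (if k = c then 1 else 0) + x k)"
        by (rule sum.cong) auto
      then show ?thesis using fA by (simp add: sum.distrib)
    qed
    have "map_pmf (\<lambda>x. sum x A) (multinomial_pmf (Suc n) q) =
        embed_pmf q \<bind> (\<lambda>c. map_pmf (\<lambda>s. (if c \<in> A then 1 else 0) + s)
          (map_pmf (\<lambda>x. sum x A) (multinomial_pmf n q)))"
      by (simp add: multinomial_pmf_Suc map_bind_pmf map_pmf_comp upd del: fun_upd_apply)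
    also have "\<dots> = map_pmf (\<lambda>c. c \<in> A) (embed_pmf q) \<bind> (\<lambda>b. map_pmf (\<lambda>s. (if b then 1 else 0) + s)
          (binomial_pmf n (sum q A)))"
      by (simp only: Suc bind_map_pmf)
    also have "\<dots> = binomial_pmf (Suc n) (sum q A)"
      unfolding B binomial_pmf_Suc[OF p] by (simp add: map_pmf_def)
    finally show ?case .
  qed
qed

lemma finite_cells [simp]: "finite (cells I J)"
  by (simp add: cells_def)

lemma sum_cells: "sum f (cells I J) = (\<Sum>i=1..I. \<Sum>j=1..J i. f (i, j))"
  unfolding cells_def by (subst sum.Sigma) (auto simp: split_def)

lemma prod_cells: "prod f (cells I J) = (\<Prod>i=1..I. \<Prod>j=1..J i. f (i, j))"
  unfolding cells_def by (subst prod.Sigma) (auto simp: split_def)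

lemma cond_probs_prob_vectors:
  assumes "m \<in> prob_vectors (cells I J)" "row_sum J m i > 0"
  shows "cond_probs J m i \<in> prob_vectors {1..J i}"
  using assms unfolding prob_vectors_def cond_probs_def
  by (auto simp: sum_divide_distrib[symmetric] cells_def row_sum_def)

lemma row_sum_le_1:
  assumes m: "m \<in> prob_vectors (cells I J)" and i: "i \<in> {1..I}"
  shows "row_sum J m i \<le> 1"
proof -
  have "row_sum J m i \<le> (\<Sum>i=1..I. row_sum J m i)"
    using i m by (intro member_le_sum) (auto simp: row_sum_def prob_vectors_def intro: sum_nonneg)
  also have "\<dots> = 1" using m by (simp add: prob_vectors_def sum_cells row_sum_def)
  finally show ?thesis .
qed

text \<open>A single trial, seen from row \<open>i\<close>, first decides by a Bernoulli draw
  whether it hits the row and then picks a column with law \<open>cond_probs J m i\<close>. Writing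
  the row as a mixture over its total avoids conditioning on the total.\<close>

lemma multinomial_row:
  assumes m: "m \<in> prob_vectors (cells I J)" and i: "i \<in> {1..I}" and pos: "row_sum J m i > 0"
  shows "map_pmf (\<lambda>X j. X (i, j)) (multinomial_pmf n m) =
    binomial_pmf n (row_sum J m i) \<bind> (\<lambda>k. multinomial_pmf k (cond_probs J m i))"
proof -
  let ?\<theta> = "row_sum J m i" and ?p = "cond_probs J m i"
  note K = finite_cells[of I J] m
  note p = finite_atLeastAtMost[of 1 "J i"] cond_probs_prob_vectors[OF m pos]
  have \<theta>: "?\<theta> \<in> {0..1}" using pos row_sum_le_1[OF m i] by simp
  \<comment> \<open>\<open>g\<close> records what a trial contributes to row \<open>i\<close>:
    \<open>None\<close> if it misses the row, otherwise the column hit. \<open>upd\<close> applies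
    this contribution to the row counts.\<close>
  define g :: "nat \<times> nat \<Rightarrow> nat option" where "g c = (if fst c = i then Some (snd c) else None)" for c
  define upd :: "nat option \<Rightarrow> (nat \<Rightarrow> nat) \<Rightarrow> nat \<Rightarrow> nat" where
    "upd d x = (case d of None \<Rightarrow> x | Some j \<Rightarrow> x(j := Suc (x j)))" for d x
  have row: "measure_pmf.prob (embed_pmf m) {c. fst c = i} = ?\<theta>"
  proof -
    have "{c. fst c = i} \<inter> cells I J = Pair i ` {1..J i}" using i by (auto simp: cells_def)
    then show ?thesis
      by (simp add: measure_embed_prob_vector[OF K] row_sum_def sum.reindex inj_on_def)
  qed
  have D: "map_pmf g (embed_pmf m) = bernoulli_pmf ?\<theta> \<bind>
      (\<lambda>b. if b then map_pmf Some (embed_pmf ?p) else return_pmf None)"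
  proof (rule pmf_eqI)
    fix d
    show "pmf (map_pmf g (embed_pmf m)) d = pmf (bernoulli_pmf ?\<theta> \<bind>
        (\<lambda>b. if b then map_pmf Some (embed_pmf ?p) else return_pmf None)) d"
    proof (cases d)
      case None
      have "g -` {None} = UNIV - {c. fst c = i}" by (auto simp: g_def)
      then have "pmf (map_pmf g (embed_pmf m)) None = 1 - ?\<theta>"
        using measure_pmf.prob_compl[of "{c. fst c = i}" "embed_pmf m"] row by (simp add: pmf_map)
      moreover have "pmf (map_pmf Some (embed_pmf ?p)) None = 0"
        by (simp add: pmf_eq_0_set_pmf)
      ultimately show ?thesis using \<theta> None by (simp add: pmf_bind)
    next
      case (Some j)
      have "g -` {Some j} = {(i, j)}" by (auto simp: g_def split: if_splits)
      then have "pmf (map_pmf g (embed_pmf m)) (Some j) = m (i, j)"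
        by (simp add: pmf_map measure_pmf_single pmf_embed_prob_vector[OF K])
      moreover have "pmf (map_pmf Some (embed_pmf ?p)) (Some j) = ?p j"
        by (simp add: pmf_map_inj' pmf_embed_prob_vector[OF p])
      ultimately show ?thesis using \<theta> Some pos by (simp add: pmf_bind cond_probs_def)
    qed
  qed
  show ?thesis
  proof (induction n)
    case 0
    then show ?case using \<theta> by (simp add: multinomial_pmf_0 binomial_pmf_0 bind_return_pmf)
  next
    case (Suc n)
    let ?B = "binomial_pmf n ?\<theta>"
    have upd_Some: "upd (Some j) = (\<lambda>x. x(j := Suc (x j)))" for j
      by (rule ext) (simp add: upd_def)
    have upd_None: "upd None = (\<lambda>x. x)"
      by (rule ext) (simp add: upd_def)
    have upd: "(\<lambda>j. (X(c := Suc (X c))) (i, j)) = upd (g c) (\<lambda>j. X (i, j))" for X c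
      by (cases c) (auto simp: upd_def g_def)
    have "map_pmf (\<lambda>X j. X (i, j)) (multinomial_pmf (Suc n) m) =
        embed_pmf m \<bind> (\<lambda>c. map_pmf (upd (g c)) (map_pmf (\<lambda>X j. X (i, j)) (multinomial_pmf n m)))"
      by (simp add: multinomial_pmf_Suc map_bind_pmf map_pmf_comp upd del: fun_upd_apply)
    also have "\<dots> = map_pmf g (embed_pmf m) \<bind>
        (\<lambda>d. map_pmf (upd d) (?B \<bind> (\<lambda>k. multinomial_pmf k ?p)))"
      by (simp only: Suc bind_map_pmf)
    also have "\<dots> = bernoulli_pmf ?\<theta> \<bind> (\<lambda>b. ?B \<bind> (\<lambda>k. multinomial_pmf ((if b then 1 else 0) + k) ?p))"
      unfolding D bind_assoc_pmf
    proof (rule bind_pmf_cong[OF refl])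
      fix b
      show "(if b then map_pmf Some (embed_pmf ?p) else return_pmf None) \<bind>
          (\<lambda>d. map_pmf (upd d) (?B \<bind> (\<lambda>k. multinomial_pmf k ?p))) =
        ?B \<bind> (\<lambda>k. multinomial_pmf ((if b then 1 else 0) + k) ?p)"
      proof (cases b)
        case True
        \<comment> \<open>The column of the new trial and the earlier row total are independent, so
          the draws commute. With the total \<open>k\<close> drawn first, the new column turns
          \<open>multinomial_pmf k\<close> into \<open>multinomial_pmf (Suc k)\<close>.\<close>
        have "embed_pmf ?p \<bind> (\<lambda>j. ?B \<bind> (\<lambda>k. map_pmf (upd (Some j)) (multinomial_pmf k ?p))) =
            ?B \<bind> (\<lambda>k. embed_pmf ?p \<bind> (\<lambda>j. map_pmf (upd (Some j)) (multinomial_pmf k ?p)))"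
          by (rule bind_commute_pmf)
        then show ?thesis using True
          by (simp add: bind_map_pmf map_bind_pmf multinomial_pmf_Suc upd_Some)
      qed (simp add: bind_return_pmf upd_None)
    qed
    also have "\<dots> = binomial_pmf (Suc n) ?\<theta> \<bind> (\<lambda>k. multinomial_pmf k ?p)"
      unfolding binomial_pmf_Suc[OF \<theta>] by (simp add: bind_assoc_pmf bind_return_pmf)
    finally show ?case .
  qed
qed

section \<open>Conditioning and a uniform bound on the loss\<close>

lemma expectation_cond_pmf:
  fixes f :: "'a \<Rightarrow> real"
  assumes "finite (set_pmf p)" "set_pmf p \<inter> S \<noteq> {}"
  shows "measure_pmf.expectation (cond_pmf p S) f =
    measure_pmf.expectation p (\<lambda>x. indicator S x * f x) / measure_pmf.prob p S"
proof -
  have "measure_pmf.expectation (cond_pmf p S) f = (\<Sum>x\<in>set_pmf p. pmf (cond_pmf p S) x *\<^sub>R f x)"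
    using assms by (intro integral_measure_pmf) auto
  also have "\<dots> = (\<Sum>x\<in>set_pmf p. pmf p x *\<^sub>R (indicator S x * f x)) / measure_pmf.prob p S"
    unfolding sum_divide_distrib using assms by (intro sum.cong) (auto simp: pmf_cond indicator_def)
  also have "(\<Sum>x\<in>set_pmf p. pmf p x *\<^sub>R (indicator S x * f x)) =
      measure_pmf.expectation p (\<lambda>x. indicator S x * f x)"
    using assms by (intro integral_measure_pmf[symmetric]) auto
  finally show ?thesis .
qed

text \<open>For \<open>0 < q k \<le> 1\<close> the number \<open>q k * ln (q k)\<close> lies between
  -1 and 0, and the remaining part is at most \<open>\<bar>ln (r k)\<bar>\<close>. The bound does
  not involve \<open>q\<close>, hence neither the sample nor \<open>n\<close>; an event of small
  probability therefore contributes little to the risk.\<close>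

lemma abs_KL_le:
  assumes q: "q \<in> prob_vectors K" and K: "finite K" and r: "\<And>k. k \<in> K \<Longrightarrow> 0 < r k"
  shows "\<bar>KL K q r\<bar> \<le> (\<Sum>k\<in>K. 1 + \<bar>ln (r k)\<bar>)"
  unfolding KL_def
proof (rule order_trans[OF sum_abs], rule sum_mono)
  fix k assume k: "k \<in> K"
  have q0: "0 \<le> q k" using q by (simp add: prob_vectors_def)
  have q1: "q k \<le> 1"
    using member_le_sum[of k K q] k q K by (auto simp: prob_vectors_def)
  show "\<bar>q k * ln (q k / r k)\<bar> \<le> 1 + \<bar>ln (r k)\<bar>"
  proof (cases "q k = 0")
    case False
    with q0 have qp: "0 < q k" by simp
    have "- ln (q k) \<le> 1 / q k - 1" using ln_le_minus_one[of "1 / q k"] qp by (simp add: ln_div)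
    then have "q k * (- ln (q k)) \<le> q k * (1 / q k - 1)" using q0 by (intro mult_left_mono)
    then have "q k * (- ln (q k)) \<le> 1" using qp by (simp add: right_diff_distrib)
    moreover have "q k * ln (q k) \<le> 0" using qp q1 by (simp add: mult_le_0_iff)
    ultimately have "\<bar>q k * ln (q k)\<bar> \<le> 1" by simp
    moreover have "\<bar>q k * ln (r k)\<bar> \<le> 1 * \<bar>ln (r k)\<bar>"
      unfolding abs_mult using q0 q1 by (intro mult_right_mono) auto
    moreover have "q k * ln (q k / r k) = q k * ln (q k) - q k * ln (r k)"
      using qp r[OF k] by (simp add: ln_div right_diff_distrib)
    ultimately show ?thesis by linarith
  qed simp
qed

section \<open>Binomial expectations\<close>

lemma binomial_expectation_Suc:
  fixes f :: "nat \<Rightarrow> real"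
  assumes p: "p \<in> {0..1}"
  shows "measure_pmf.expectation (binomial_pmf (Suc n) p) f =
    measure_pmf.expectation (binomial_pmf n p) (\<lambda>k. p * f (Suc k) + (1 - p) * f k)"
proof -
  have "measure_pmf.expectation (binomial_pmf (Suc n) p) f =
    (\<Sum>b\<in>UNIV. pmf (bernoulli_pmf p) b *\<^sub>R
       measure_pmf.expectation (binomial_pmf n p \<bind> (\<lambda>k. return_pmf ((if b then 1 else 0) + k))) f)"
    unfolding binomial_pmf_Suc[OF p]
    by (rule pmf_expectation_bind) (use p in \<open>auto simp: finite_set_pmf_binomial_pmf\<close>)
  also have "\<dots> = p * measure_pmf.expectation (binomial_pmf n p) (\<lambda>k. f (Suc k))
      + (1 - p) * measure_pmf.expectation (binomial_pmf n p) f"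
    using p by (simp add: UNIV_bool map_pmf_def[symmetric])
  finally show ?thesis using p by simp
qed

text \<open>Weighting the binomial law by \<open>k\<close> yields the law of one plus a binomial
  variable with one trial fewer. Read from right to left, it cancels the first factor of a
  denominator \<open>(k + 1) * (k + 2) * ...\<close> at the price of one more trial.\<close>

lemma binomial_expectation_size_bias:
  fixes f :: "nat \<Rightarrow> real"
  assumes p: "p \<in> {0..1}"
  shows "measure_pmf.expectation (binomial_pmf (Suc n) p) (\<lambda>k. real k * f k) =
    real (Suc n) * p * measure_pmf.expectation (binomial_pmf n p) (\<lambda>k. f (Suc k))"
proof -
  have *: "real (Suc n choose Suc k) * p ^ Suc k * (1 - p) ^ (n - k) * (real (Suc k) * f (Suc k))
      = real (Suc n) * p * (real (n choose k) * p ^ k * (1 - p) ^ (n - k) * f (Suc k))" for k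
  proof -
    have "real (Suc k) * real (Suc n choose Suc k) = real (Suc n) * real (n choose k)"
      using arg_cong[OF Suc_times_binomial[of k n], of real] by (simp only: of_nat_mult)
    then have "(real (Suc k) * real (Suc n choose Suc k)) * (p * p ^ k * (1 - p) ^ (n - k) * f (Suc k))
        = (real (Suc n) * real (n choose k)) * (p * p ^ k * (1 - p) ^ (n - k) * f (Suc k))"
      by (rule arg_cong)
    then show ?thesis by (simp only: power_Suc mult_ac)
  qed
  show ?thesis
    unfolding expectation_binomial_pmf'[OF p]
    by (subst sum.atMost_Suc_shift) (simp add: * sum_distrib_left del: of_nat_Suc power_Suc binomial_Suc_Suc)
qed

lemma binomial_expectation_zero:
  fixes c :: real
  assumes p: "p \<in> {0..1}"
  shows "measure_pmf.expectation (binomial_pmf n p) (\<lambda>k. if k = 0 then c else 0) = (1 - p) ^ n * c"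
  unfolding expectation_binomial_pmf'[OF p] by (simp add: if_distrib sum.delta cong: if_cong)

lemma binomial_expectation_inverse_Suc:
  assumes p: "0 < p" "p \<le> 1"
  shows "measure_pmf.expectation (binomial_pmf n p) (\<lambda>k. 1 / (real k + 1)) =
    (1 - (1 - p) ^ (n + 1)) / ((real n + 1) * p)"
proof -
  have p': "p \<in> {0..1}" using p by simp
  have "real (Suc n) * p * measure_pmf.expectation (binomial_pmf n p) (\<lambda>k. 1 / real (Suc k)) =
      measure_pmf.expectation (binomial_pmf (Suc n) p) (\<lambda>k. real k * (1 / real k))"
    by (rule binomial_expectation_size_bias[OF p', symmetric])
  \<comment> \<open>The product \<open>real k * (1 / real k)\<close> is 1 except at
    \<open>k = 0\<close>, where it is 0. This defect produces the exponentially small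
    correction.\<close>
  also have "\<dots> = measure_pmf.expectation (binomial_pmf (Suc n) p) (\<lambda>k. 1 - (if k = 0 then 1 else 0))"
    by (rule Bochner_Integration.integral_cong) auto
  also have "\<dots> = 1 - (1 - p) ^ (n + 1)"
    using p' by (simp add: binomial_expectation_zero)
  finally have "(real n + 1) * p * measure_pmf.expectation (binomial_pmf n p) (\<lambda>k. 1 / (real k + 1)) =
    1 - (1 - p) ^ (n + 1)" by (simp add: add_ac)
  then show ?thesis using p by (subst nonzero_eq_divide_eq) (auto simp: mult_ac)
qed

lemma binomial_expectation_inverse_Suc2:
  assumes p: "0 < p" "p \<le> 1"
  shows "measure_pmf.expectation (binomial_pmf n p) (\<lambda>k. 1 / ((real k + 1) * (real k + 2))) =
    ((1 - (1 - p) ^ (n + 2)) / ((real n + 2) * p) - (1 - p) ^ (n + 1)) / ((real n + 1) * p)"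
proof -
  have p': "p \<in> {0..1}" using p by simp
  have "real (Suc n) * p * measure_pmf.expectation (binomial_pmf n p)
        (\<lambda>k. 1 / (real (Suc k) * (real (Suc k) + 1))) =
      measure_pmf.expectation (binomial_pmf (Suc n) p) (\<lambda>k. real k * (1 / (real k * (real k + 1))))"
    by (rule binomial_expectation_size_bias[OF p', symmetric])
  also have "\<dots> = measure_pmf.expectation (binomial_pmf (Suc n) p)
      (\<lambda>k. 1 / (real k + 1) - (if k = 0 then 1 else 0))"
    by (rule Bochner_Integration.integral_cong) auto
  also have "\<dots> = (1 - (1 - p) ^ (n + 2)) / ((real n + 2) * p) - (1 - p) ^ (n + 1)"
    using p' binomial_expectation_inverse_Suc[OF p, of "Suc n"]
    by (simp add: binomial_expectation_zero)
  finally have "(real n + 1) * p * measure_pmf.expectation (binomial_pmf n p)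
        (\<lambda>k. 1 / ((real k + 1) * (real k + 2))) =
      (1 - (1 - p) ^ (n + 2)) / ((real n + 2) * p) - (1 - p) ^ (n + 1)" by (simp add: add_ac)
  then show ?thesis using p by (subst nonzero_eq_divide_eq) (auto simp only: mult_ac mult_eq_0_iff)
qed

lemma binomial_expectation_inverse_Suc2_le:
  assumes p: "0 < p" "p \<le> 1"
  shows "measure_pmf.expectation (binomial_pmf n p) (\<lambda>k. 1 / ((real k + 1) * (real k + 2))) \<le>
    1 / ((real n + 1) * (real n + 2) * p ^ 2)"
proof -
  have "measure_pmf.expectation (binomial_pmf n p) (\<lambda>k. 1 / ((real k + 1) * (real k + 2))) \<le>
      (1 / ((real n + 2) * p)) / ((real n + 1) * p)"
    unfolding binomial_expectation_inverse_Suc2[OF p]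
  proof (rule divide_right_mono)
    have "(1 - (1 - p) ^ (n + 2)) / ((real n + 2) * p) \<le> 1 / ((real n + 2) * p)"
      using p by (intro divide_right_mono) auto
    moreover have "0 \<le> (1 - p) ^ (n + 1)" using p by simp
    ultimately show "(1 - (1 - p) ^ (n + 2)) / ((real n + 2) * p) - (1 - p) ^ (n + 1)
        \<le> 1 / ((real n + 2) * p)" by linarith
  qed (use p in simp)
  then show ?thesis by (simp add: power2_eq_square mult_ac)
qed

lemma binomial_expectation_inverse_Suc3_le:
  assumes p: "0 < p" "p \<le> 1"
  shows "measure_pmf.expectation (binomial_pmf n p)
      (\<lambda>k. 1 / ((real k + 1) * (real k + 2) * (real k + 3))) \<le>
    1 / ((real n + 1) * (real n + 2) * (real n + 3) * p ^ 3)"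
proof -
  have p': "p \<in> {0..1}" using p by simp
  have "real (Suc n) * p * measure_pmf.expectation (binomial_pmf n p)
        (\<lambda>k. 1 / (real (Suc k) * (real (Suc k) + 1) * (real (Suc k) + 2))) =
      measure_pmf.expectation (binomial_pmf (Suc n) p)
        (\<lambda>k. real k * (1 / (real k * (real k + 1) * (real k + 2))))"
    by (rule binomial_expectation_size_bias[OF p', symmetric])
  also have "\<dots> \<le> measure_pmf.expectation (binomial_pmf (Suc n) p)
      (\<lambda>k. 1 / ((real k + 1) * (real k + 2)))"
    using p' by (intro integral_mono) auto
  also have "\<dots> \<le> 1 / ((real n + 2) * (real n + 3) * p ^ 2)"
    using binomial_expectation_inverse_Suc2_le[OF p, of "Suc n"] by (simp add: add_ac)
  finally have "(real n + 1) * p * measure_pmf.expectation (binomial_pmf n p)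
      (\<lambda>k. 1 / ((real k + 1) * (real k + 2) * (real k + 3))) \<le> 1 / ((real n + 2) * (real n + 3) * p ^ 2)"
    by (simp add: add_ac)
  then have "measure_pmf.expectation (binomial_pmf n p)
      (\<lambda>k. 1 / ((real k + 1) * (real k + 2) * (real k + 3)))
      \<le> 1 / ((real n + 2) * (real n + 3) * p ^ 2) / ((real n + 1) * p)"
    using p by (subst pos_le_divide_eq) (auto simp: mult_ac)
  then show ?thesis by (simp add: power3_eq_cube power2_eq_square mult_ac)
qed

text \<open>Dominating \<open>e k\<close> by \<open>\<epsilon> / ((k+1)(k+2)) + C / ((k+1)(k+2)(k+3))\<close> for all \<open>k\<close>, including small ones,
  makes tail estimates for the binomial distribution unnecessary.\<close>

lemma binomial_expectation_smallo:
  fixes e :: "nat \<Rightarrow> real"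
  assumes p: "0 < p" "p \<le> 1" and e: "e \<in> o(\<lambda>n. 1 / real n ^ 2)"
  shows "(\<lambda>n. measure_pmf.expectation (binomial_pmf n p) e) \<in> o(\<lambda>n. 1 / real n ^ 2)"
proof (rule landau_o.smallI)
  fix c :: real assume c: "0 < c"
  have p': "p \<in> {0..1}" using p by simp
  \<comment> \<open>The factor 6 in 12 pays for \<open>(k + 1) * (k + 2) \<le> 6 * k^2\<close>,
    valid from \<open>k = 1\<close> on, and \<open>p ^ 2\<close> for the inverse second-order
    moment. What is left is \<open>c / 2\<close>, half of the allowed error.\<close>
  let ?\<epsilon> = "c * p ^ 2 / 12"
  have "eventually (\<lambda>k. norm (e k) \<le> ?\<epsilon> * norm (1 / real k ^ 2)) sequentially"
    using landau_o.smallD[OF e, of ?\<epsilon>] c p by simp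
  then obtain N0 where N0: "\<And>k. k \<ge> N0 \<Longrightarrow> norm (e k) \<le> ?\<epsilon> * norm (1 / real k ^ 2)"
    by (auto simp: eventually_sequentially)
  define N where "N = max 1 N0"
  define w where "w k = (real k + 1) * (real k + 2) * (real k + 3)" for k
  \<comment> \<open>\<open>C\<close> covers the finitely many \<open>k\<close> at which
    \<open>e\<close> is not yet small. However large it is, it is harmless, since the mean of
    \<open>1 / w k\<close> is of order \<open>1 / n^3\<close>.\<close>
  define C where "C = (\<Sum>k<N. \<bar>e k\<bar> * w k)"
  have w: "w k > 0" for k by (simp add: w_def add_pos_nonneg)
  have C: "C \<ge> 0" unfolding C_def by (intro sum_nonneg mult_nonneg_nonneg) (auto intro: less_imp_le[OF w])
  have bound: "\<bar>e k\<bar> \<le> 6 * ?\<epsilon> * (1 / ((real k + 1) * (real k + 2))) + C * (1 / w k)" for k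
  proof (cases "k < N")
    case True
    have "\<bar>e k\<bar> * w k \<le> C" unfolding C_def
      using True by (intro member_le_sum) (auto intro!: mult_nonneg_nonneg less_imp_le[OF w])
    then have "\<bar>e k\<bar> \<le> C * (1 / w k)" using w[of k] by (simp add: field_simps)
    moreover have "0 \<le> 6 * ?\<epsilon> * (1 / ((real k + 1) * (real k + 2)))" using c by simp
    ultimately show ?thesis by linarith
  next
    case False
    then have k: "k \<ge> 1" "k \<ge> N0" unfolding N_def by auto
    have "(real k + 1) * (real k + 2) \<le> (2 * real k) * (3 * real k)"
      using k by (intro mult_mono) auto
    then have "1 / real k ^ 2 \<le> 6 * (1 / ((real k + 1) * (real k + 2)))"
      using k by (simp add: field_simps power2_eq_square)
    then have "?\<epsilon> * (1 / real k ^ 2) \<le> ?\<epsilon> * (6 * (1 / ((real k + 1) * (real k + 2))))"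
      using c by (intro mult_left_mono) auto
    moreover have "\<bar>e k\<bar> \<le> ?\<epsilon> * (1 / real k ^ 2)" using N0[OF k(2)] by simp
    moreover have "0 \<le> C * (1 / w k)" using C w[of k] by simp
    ultimately show ?thesis by linarith
  qed
  have est: "\<bar>measure_pmf.expectation (binomial_pmf n p) e\<bar> \<le>
      c / 2 * (1 / ((real n + 1) * (real n + 2))) + C / p ^ 3 * (1 / w n)" for n
  proof -
    have "\<bar>measure_pmf.expectation (binomial_pmf n p) e\<bar> \<le> measure_pmf.expectation (binomial_pmf n p) (\<lambda>k. \<bar>e k\<bar>)"
      by (rule integral_abs_bound)
    also have "\<dots> \<le> measure_pmf.expectation (binomial_pmf n p)
        (\<lambda>k. 6 * ?\<epsilon> * (1 / ((real k + 1) * (real k + 2))) + C * (1 / w k))"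
      using p' bound by (intro integral_mono) auto
    also have "\<dots> = 6 * ?\<epsilon> * measure_pmf.expectation (binomial_pmf n p) (\<lambda>k. 1 / ((real k + 1) * (real k + 2)))
       + C * measure_pmf.expectation (binomial_pmf n p) (\<lambda>k. 1 / w k)"
      by (subst Bochner_Integration.integral_add) (use p' in \<open>auto simp only: integral_mult_right_zero integrable_binomial_pmf\<close>)
    also have "\<dots> \<le> 6 * ?\<epsilon> * (1 / ((real n + 1) * (real n + 2) * p ^ 2)) + C * (1 / (w n * p ^ 3))"
      using binomial_expectation_inverse_Suc2_le[OF p, of n] binomial_expectation_inverse_Suc3_le[OF p, of n] c C
      by (intro add_mono mult_left_mono) (auto simp: w_def)
    also have "\<dots> = c / 2 * (1 / ((real n + 1) * (real n + 2))) + C / p ^ 3 * (1 / w n)"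
      using p by simp
    finally show ?thesis .
  qed
  show "\<forall>\<^sub>F n in sequentially. norm (measure_pmf.expectation (binomial_pmf n p) e) \<le> c * norm (1 / real n ^ 2)"
    using eventually_gt_at_top[of "nat \<lceil>2 * (C / p ^ 3) / c\<rceil>"]
  proof eventually_elim
    case (elim n)
    have n: "n > 0" "2 * (C / p ^ 3) / c \<le> real n" using elim by linarith+
    have C': "C / p ^ 3 \<le> c / 2 * real n" using n(2) c
      by (simp only: pos_divide_le_eq) (simp add: mult_ac)
    have "1 / ((real n + 1) * (real n + 2)) \<le> 1 / real n ^ 2"
      using n by (intro divide_left_mono) (auto simp: power2_eq_square intro!: mult_mono)
    then have 1: "c / 2 * (1 / ((real n + 1) * (real n + 2))) \<le> c / 2 * (1 / real n ^ 2)"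
      using c by (intro mult_left_mono) auto
    have "C / p ^ 3 * (1 / w n) \<le> c / 2 * real n * (1 / (real n * real n * real n))"
      using n C C' c p unfolding w_def by (intro mult_mono divide_left_mono) (auto intro!: mult_mono)
    also have "\<dots> = c / 2 * (1 / real n ^ 2)" using n by (simp add: power2_eq_square)
    finally show ?case using est[of n] 1 by simp
  qed
qed

lemma power_smallo_inverse_square:
  fixes c :: real
  assumes "\<bar>c\<bar> < 1"
  shows "(\<lambda>n. c ^ n) \<in> o(\<lambda>n. 1 / real n ^ 2)"
proof (cases "c = 0")
  case True
  have "eventually (\<lambda>n. c ^ n = 0) sequentially"
    using eventually_gt_at_top[of 0] by eventually_elim (simp add: True)
  then show ?thesis by (subst landau_o.small.in_cong[where g = "\<lambda>_. 0"]) auto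
next
  case False
  \<comment> \<open>The square root distributes the factor \<open>n^2\<close>:
    \<open>n^2 * \<bar>c\<bar>^n\<close> is the square of \<open>n * d^n\<close>, which tends to
    0.\<close>
  define d where "d = sqrt \<bar>c\<bar>"
  have d: "0 < d" "d < 1" "\<bar>c\<bar> = d ^ 2" using assms False by (auto simp: d_def)
  have "(\<lambda>n. real n * d ^ n) \<longlonglongrightarrow> 0"
    using powser_times_n_limit_0[of d] d by simp
  then have "(\<lambda>n. (real n * d ^ n) ^ 2) \<longlonglongrightarrow> 0 ^ 2" by (rule tendsto_power)
  then have "(\<lambda>n. \<bar>c ^ n / (1 / real n ^ 2)\<bar>) \<longlonglongrightarrow> 0"
    using d by (simp add: power_mult_distrib power_abs abs_mult power_mult[symmetric] mult.commute)
  then have "(\<lambda>n. c ^ n / (1 / real n ^ 2)) \<longlonglongrightarrow> 0" by (rule tendsto_rabs_zero_cancel)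
  then show ?thesis
    by (intro smalloI_tendsto) (auto intro: eventually_mono[OF eventually_gt_at_top[of 0]])
qed

text \<open>Up to terms of order \<open>1 / k^3\<close>, \<open>1 / k\<close> equals
  \<open>1 / (k + 1) + 1 / ((k + 1) * (k + 2))\<close> and \<open>1 / k^2\<close> equals
  \<open>1 / ((k + 1) * (k + 2))\<close>. This gives the coefficients \<open>a\<close> and
  \<open>a + b\<close> in \<open>e\<close>. Taking means and expanding \<open>1 / (n + 1)\<close>
  turns the second-order coefficient into \<open>(a + b) / p^2 - a / p\<close>, that is
  \<open>(b + a * (1 - p)) / p^2\<close>.\<close>

lemma binomial_expectation_expansion:
  fixes f :: "nat \<Rightarrow> real"
  assumes p: "0 < p" "p \<le> 1"
    and f: "(\<lambda>k. f k - (a / real k + b / real k ^ 2)) \<in> o(\<lambda>n. 1 / real n ^ 2)"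
  shows "(\<lambda>n. measure_pmf.expectation (binomial_pmf n p) f
      - (a / (real n * p) + (b + a * (1 - p)) / (real n * p) ^ 2)) \<in> o(\<lambda>n. 1 / real n ^ 2)"
proof -
  have p': "p \<in> {0..1}" using p by simp
  define e where "e k = f k - (a * (1 / (real k + 1)) + (a + b) * (1 / ((real k + 1) * (real k + 2))))" for k
  have "(\<lambda>k. (a / real k + b / real k ^ 2) -
      (a * (1 / (real k + 1)) + (a + b) * (1 / ((real k + 1) * (real k + 2))))) \<in> o(\<lambda>n. 1 / real n ^ 2)"
  proof -
    have "(\<lambda>k. 1 / real k - 1 / (real k + 1) - 1 / ((real k + 1) * (real k + 2))) \<in> o(\<lambda>n. 1 / real n ^ 2)"
      "(\<lambda>k. 1 / real k ^ 2 - 1 / ((real k + 1) * (real k + 2))) \<in> o(\<lambda>n. 1 / real n ^ 2)"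
      by real_asymp+
    then have "(\<lambda>k. a * (1 / real k - 1 / (real k + 1) - 1 / ((real k + 1) * (real k + 2)))
       + b * (1 / real k ^ 2 - 1 / ((real k + 1) * (real k + 2)))) \<in> o(\<lambda>n. 1 / real n ^ 2)"
      by (intro sum_in_smallo) auto
    moreover have "a * (1 / real k - 1 / (real k + 1) - 1 / ((real k + 1) * (real k + 2)))
       + b * (1 / real k ^ 2 - 1 / ((real k + 1) * (real k + 2))) =
       (a / real k + b / real k ^ 2) -
       (a * (1 / (real k + 1)) + (a + b) * (1 / ((real k + 1) * (real k + 2))))" for k
      by (simp only: right_diff_distrib distrib_right) simp
    ultimately show ?thesis by simp
  qed
  from sum_in_smallo(1)[OF f this] have e: "e \<in> o(\<lambda>n. 1 / real n ^ 2)"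
    unfolding e_def[abs_def] by (simp only: diff_add_eq add_diff_eq diff_add_cancel add_diff_cancel_right')
  \<comment> \<open>The probability of a zero count. It collects all \<open>k = 0\<close>
    corrections, the exponents \<open>n + 1\<close> and \<open>n + 2\<close> being split as
    \<open>\<delta> n\<close> times a constant.\<close>
  define \<delta> where "\<delta> n = (1 - p) ^ n" for n
  have \<delta>: "\<delta> \<in> o(\<lambda>n. 1 / real n ^ 2)"
    unfolding \<delta>_def[abs_def] using p by (intro power_smallo_inverse_square) auto
  have E: "measure_pmf.expectation (binomial_pmf n p) f =
      measure_pmf.expectation (binomial_pmf n p) e
      + a * ((1 - (1 - p) * \<delta> n) / ((real n + 1) * p))
      + (a + b) * (((1 - (1 - p) ^ 2 * \<delta> n) / ((real n + 2) * p) - (1 - p) * \<delta> n) / ((real n + 1) * p))" for n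
  proof -
    have "measure_pmf.expectation (binomial_pmf n p) f = measure_pmf.expectation (binomial_pmf n p)
       (\<lambda>k. e k + (a * (1 / (real k + 1)) + (a + b) * (1 / ((real k + 1) * (real k + 2)))))"
      by (simp add: e_def)
    also have "\<dots> = measure_pmf.expectation (binomial_pmf n p) e
      + (a * measure_pmf.expectation (binomial_pmf n p) (\<lambda>k. 1 / (real k + 1))
         + (a + b) * measure_pmf.expectation (binomial_pmf n p) (\<lambda>k. 1 / ((real k + 1) * (real k + 2))))"
      using p' by (simp only: Bochner_Integration.integral_add integrable_binomial_pmf integral_mult_right_zero)
    finally show ?thesis
      unfolding binomial_expectation_inverse_Suc[OF p] binomial_expectation_inverse_Suc2[OF p] \<delta>_def
      by (simp add: power_add power2_eq_square mult_ac)
  qed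
  have split: "measure_pmf.expectation (binomial_pmf n p) f
      - (a / (real n * p) + (b + a * (1 - p)) / (real n * p) ^ 2) =
      measure_pmf.expectation (binomial_pmf n p) e
      + a / p * (1 / (real n + 1) - 1 / real n + 1 / real n ^ 2)
      + (a + b) / p ^ 2 * (1 / ((real n + 1) * (real n + 2)) - 1 / real n ^ 2)
      - \<delta> n * ((a * (1 - p) / p + (a + b) * (1 - p) / p) * (1 / (real n + 1))
               + (a + b) * (1 - p) ^ 2 / p ^ 2 * (1 / ((real n + 1) * (real n + 2))))" if "n > 0" for n
  proof -
    have a1: "a * ((1 - (1 - p) * \<delta> n) / ((real n + 1) * p)) =
       a / p * (1 / (real n + 1)) - \<delta> n * (a * (1 - p) / p * (1 / (real n + 1)))"
      by (simp add: diff_divide_distrib right_diff_distrib mult_ac)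
    have a2: "(a + b) * (((1 - (1 - p) ^ 2 * \<delta> n) / ((real n + 2) * p) - (1 - p) * \<delta> n) / ((real n + 1) * p)) =
       (a + b) / p ^ 2 * (1 / ((real n + 1) * (real n + 2)))
        - \<delta> n * ((a + b) * (1 - p) / p * (1 / (real n + 1))
          + (a + b) * (1 - p) ^ 2 / p ^ 2 * (1 / ((real n + 1) * (real n + 2))))"
      using p by (simp add: power2_eq_square divide_simps) algebra
    have a3: "a / (real n * p) + (b + a * (1 - p)) / (real n * p) ^ 2 =
       a / p * (1 / real n) - a / p * (1 / real n ^ 2) + (a + b) / p ^ 2 * (1 / real n ^ 2)"
      using p that by (simp add: power2_eq_square divide_simps) algebra
    show ?thesis unfolding E a1 a2 a3 by (simp add: algebra_simps)
  qed
  have r: "(\<lambda>n. 1 / (real n + 1) - 1 / real n + 1 / real n ^ 2) \<in> o(\<lambda>n. 1 / real n ^ 2)"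
    "(\<lambda>n. 1 / ((real n + 1) * (real n + 2)) - 1 / real n ^ 2) \<in> o(\<lambda>n. 1 / real n ^ 2)"
    by real_asymp+
  have "(\<lambda>n. x * (1 / (real n + 1)) + y * (1 / ((real n + 1) * (real n + 2)))) \<in> O(\<lambda>_. 1)" for x y :: real
  proof -
    have "(\<lambda>n. 1 / (real n + 1)) \<in> O(\<lambda>_. 1)" "(\<lambda>n. 1 / ((real n + 1) * (real n + 2))) \<in> O(\<lambda>_. 1)"
      by real_asymp+
    then show ?thesis by (intro sum_in_bigo(1) landau_o.big.mult_in_1) auto
  qed
  from landau_o.small_big_mult[OF \<delta> this]
  have d: "(\<lambda>n. \<delta> n * (x * (1 / (real n + 1)) + y * (1 / ((real n + 1) * (real n + 2)))))
      \<in> o(\<lambda>n. 1 / real n ^ 2)" for x y :: real by simp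
  have sm: "(\<lambda>n. x * h n) \<in> o(\<lambda>n. 1 / real n ^ 2)" if "h \<in> o(\<lambda>n. 1 / real n ^ 2)"
    for x :: real and h :: "nat \<Rightarrow> real"
    using that by (cases "x = 0") simp_all
  have "(\<lambda>n. measure_pmf.expectation (binomial_pmf n p) e
      + a / p * (1 / (real n + 1) - 1 / real n + 1 / real n ^ 2)
      + (a + b) / p ^ 2 * (1 / ((real n + 1) * (real n + 2)) - 1 / real n ^ 2)
      - \<delta> n * ((a * (1 - p) / p + (a + b) * (1 - p) / p) * (1 / (real n + 1))
               + (a + b) * (1 - p) ^ 2 / p ^ 2 * (1 / ((real n + 1) * (real n + 2)))))
      \<in> o(\<lambda>n. 1 / real n ^ 2)"
    by (intro sum_in_smallo(1) sum_in_smallo(2) binomial_expectation_smallo[OF p e] d sm r)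
  then show ?thesis
    by (rule landau_o.small.ev_eq_trans2[rotated])
       (rule eventually_mono[OF eventually_gt_at_top[of 0]], rule split)
qed


section \<open>The loss of a relative frequency to second order\<close>

lemma x_ln_x_taylor:
  fixes \<epsilon> :: real
  assumes \<epsilon>: "0 < \<epsilon>"
  obtains C where "0 \<le> C"
    "\<And>u. -1 \<le> u \<Longrightarrow> \<bar>(1 + u) * ln (1 + u) - (u + u ^ 2 / 2 - u ^ 3 / 6 + u ^ 4 / 12)\<bar> \<le> \<epsilon> * u ^ 4 + C * u ^ 6"
proof -
  \<comment> \<open>The remainder is \<open>o(u^4)\<close> at 0 and is dominated by
    \<open>u^6\<close> away from 0. For the scaled deviation \<open>u\<close> of a binomial variable
    these powers have means of order \<open>1 / n^2\<close> and \<open>1 / n^3\<close>, so a small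
    \<epsilon> is needed for the first while any \<open>C\<close> will do for the second.\<close>
  define r :: "real \<Rightarrow> real" where "r u = (1 + u) * ln (1 + u) - (u + u ^ 2 / 2 - u ^ 3 / 6 + u ^ 4 / 12)" for u
  have "((\<lambda>u. ((1 + u) * ln (1 + u) - (u + u ^ 2 / 2 - u ^ 3 / 6 + u ^ 4 / 12)) / u ^ 4) \<longlongrightarrow> 0) (at_left (0::real))"
    by real_asymp
  moreover have "((\<lambda>u. ((1 + u) * ln (1 + u) - (u + u ^ 2 / 2 - u ^ 3 / 6 + u ^ 4 / 12)) / u ^ 4) \<longlongrightarrow> 0) (at_right (0::real))"
    by real_asymp
  ultimately have "((\<lambda>u. r u / u ^ 4) \<longlongrightarrow> 0) (at 0)"
    unfolding r_def by (simp add: filterlim_split_at)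
  then have "eventually (\<lambda>u. dist (r u / u ^ 4) 0 < \<epsilon>) (at 0)"
    using \<epsilon> by (rule tendstoD)
  then obtain d where d: "d > 0" "\<And>u. u \<noteq> 0 \<Longrightarrow> \<bar>u\<bar> < d \<Longrightarrow> \<bar>r u / u ^ 4\<bar> < \<epsilon>"
    by (auto simp: eventually_at)
  define \<delta> where "\<delta> = min d 1"
  have \<delta>: "0 < \<delta>" "\<delta> \<le> 1" "\<delta> \<le> d" using d by (auto simp: \<delta>_def)
  \<comment> \<open>For \<open>\<bar>u\<bar> \<ge> \<delta>\<close> every power of
    \<open>\<bar>u\<bar>\<close> up to the sixth is at most
    \<open>(\<bar>u\<bar> / \<delta>)^6\<close>, because \<open>\<delta> \<le> 1\<close>. The
    coefficients in the bound for the remainder add up to less than 6.\<close>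
  define C where "C = 6 / \<delta> ^ 6"
  have near: "\<bar>r u\<bar> \<le> \<epsilon> * u ^ 4" if "\<bar>u\<bar> < \<delta>" for u
  proof (cases "u = 0")
    case False
    then have "\<bar>r u\<bar> / u ^ 4 < \<epsilon>" using d(2)[of u] that \<delta> by simp
    then show ?thesis using False by (simp add: pos_divide_less_eq)
  qed (simp add: r_def)
  have far: "\<bar>r u\<bar> \<le> C * u ^ 6" if u: "-1 \<le> u" "\<delta> \<le> \<bar>u\<bar>" for u
  proof -
    define v where "v = \<bar>u\<bar> / \<delta>"
    have "\<bar>u\<bar> * \<delta> \<le> \<bar>u\<bar> * 1" using \<delta> by (intro mult_left_mono) auto
    then have v: "1 \<le> v" "\<bar>u\<bar> \<le> v" using u \<delta> by (auto simp: v_def pos_le_divide_eq)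
    have pow: "\<bar>u\<bar> ^ k \<le> v ^ 6" if "k \<le> 6" for k
    proof -
      have "\<bar>u\<bar> ^ k \<le> v ^ k" using v by (intro power_mono) auto
      also have "\<dots> \<le> v ^ 6" using v that by (intro power_increasing) auto
      finally show ?thesis .
    qed
    \<comment> \<open>The value lies between \<open>u\<close> and \<open>(1 + u) * u\<close>, by
      \<open>ln t \<le> t - 1\<close> at \<open>t = 1 / (1 + u)\<close> and at
      \<open>t = 1 + u\<close>. At the endpoint \<open>u = -1\<close> it is 0.\<close>
    have "\<bar>(1 + u) * ln (1 + u)\<bar> \<le> \<bar>u\<bar> + u ^ 2"
    proof (cases "u = -1")
      case False
      then have u': "u > -1" using u by simp
      have "(1 + u) * ln (1 + u) \<le> (1 + u) * u"
        using u' ln_le_minus_one[of "1 + u"] by (intro mult_left_mono) auto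
      moreover have "u \<le> (1 + u) * ln (1 + u)"
      proof -
        have "- ln (1 + u) \<le> 1 / (1 + u) - 1"
          using u' ln_le_minus_one[of "1 / (1 + u)"] by (simp add: ln_div)
        then have "(1 + u) * (- ln (1 + u)) \<le> (1 + u) * (1 / (1 + u) - 1)"
          using u' by (intro mult_left_mono) auto
        also have "\<dots> = - u" using u' by (simp add: right_diff_distrib)
        finally show ?thesis by simp
      qed
      ultimately show ?thesis by (simp add: power2_eq_square algebra_simps abs_if)
    qed simp
    then have "\<bar>r u\<bar> \<le> \<bar>u\<bar> + u ^ 2 + (\<bar>u\<bar> + u ^ 2 / 2 + \<bar>u\<bar> ^ 3 / 6 + u ^ 4 / 12)"
    proof -
      have "0 \<le> u ^ 2" "0 \<le> u ^ 4" "\<bar>u ^ 3\<bar> = \<bar>u\<bar> ^ 3" by (auto simp: power_abs)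
      moreover assume "\<bar>(1 + u) * ln (1 + u)\<bar> \<le> \<bar>u\<bar> + u ^ 2"
      ultimately show ?thesis unfolding r_def by linarith
    qed
    also have "\<dots> \<le> 6 * v ^ 6"
      using pow[of 1] pow[of 2] pow[of 3] pow[of 4] v by simp
    also have "\<dots> = C * u ^ 6"
      by (simp add: C_def v_def power_divide)
    finally show ?thesis .
  qed
  show ?thesis
  proof (rule that)
    show "0 \<le> C" using \<delta> by (simp add: C_def)
    fix u :: real assume u: "-1 \<le> u"
    have "0 \<le> C * u ^ 6" "0 \<le> \<epsilon> * u ^ 4" using \<delta> \<epsilon> by (auto simp: C_def)
    then show "\<bar>(1 + u) * ln (1 + u) - (u + u ^ 2 / 2 - u ^ 3 / 6 + u ^ 4 / 12)\<bar> \<le> \<epsilon> * u ^ 4 + C * u ^ 6"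
      using near[of u] far[of u] u unfolding r_def by (cases "\<bar>u\<bar> < \<delta>") auto
  qed
qed

lemma binomial_central_moment_Suc:
  assumes p: "p \<in> {0..1}"
  shows "measure_pmf.expectation (binomial_pmf (Suc n) p) (\<lambda>k. (real k - real (Suc n) * p) ^ r) =
    measure_pmf.expectation (binomial_pmf n p)
      (\<lambda>k. p * ((real k - real n * p) + (1 - p)) ^ r + (1 - p) * ((real k - real n * p) - p) ^ r)"
  by (subst binomial_expectation_Suc[OF p]) (simp add: algebra_simps)

text \<open>One more trial adds an independent centred Bernoulli variable. As that variable has mean
  0, the coefficient of \<open>z^(r - 1)\<close> in the recursion for order \<open>r\<close>
  vanishes. Hence the sixth moment is reached without the fifth, and the general form in
  \<open>S\<close> has no fifth-order term.\<close>

lemma binomial_central_moments: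
  fixes p :: real
  defines "M n r \<equiv> measure_pmf.expectation (binomial_pmf n p) (\<lambda>k. (real k - real n * p) ^ r)"
  assumes p: "p \<in> {0..1}"
  shows "M n 1 = 0"
    and "M n 2 = real n * (p * (1 - p))"
    and "M n 3 = real n * (p * (1 - p) * (1 - 2 * p))"
    and "M n 4 = real n * (p * (1 - p) * (1 - 3 * p * (1 - p))) + 3 * real n * (real n - 1) * (p * (1 - p)) ^ 2"
    and "M n 6 \<le> 100 * real n ^ 3"
proof -
  have I: "measure_pmf.expectation (binomial_pmf n p)
      (\<lambda>k. c0 + c1 * (real k - real n * p) ^ 1 + c2 * (real k - real n * p) ^ 2
         + c3 * (real k - real n * p) ^ 3 + c4 * (real k - real n * p) ^ 4 + c6 * (real k - real n * p) ^ 6)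
      = c0 + c1 * M n 1 + c2 * M n 2 + c3 * M n 3 + c4 * M n 4 + c6 * M n 6" for n c0 c1 c2 c3 c4 c6
    unfolding M_def using p
    by (simp only: Bochner_Integration.integral_add integrable_binomial_pmf integral_mult_right_zero) simp
  have M0: "M 0 r = 0" if "r > 0" for r
    using p that by (simp add: M_def binomial_pmf_0)
  have S: "M (Suc n) r = c0 + c1 * M n 1 + c2 * M n 2 + c3 * M n 3 + c4 * M n 4 + c6 * M n 6"
    if "\<And>z. p * (z + (1 - p)) ^ r + (1 - p) * (z - p) ^ r =
      c0 + c1 * z ^ 1 + c2 * z ^ 2 + c3 * z ^ 3 + c4 * z ^ 4 + c6 * z ^ 6" for n r c0 c1 c2 c3 c4 c6
    using I[of n c0 c1 c2 c3 c4 c6] binomial_central_moment_Suc[OF p, of n r] that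
    unfolding M_def by presburger
  define v where "v = p * (1 - p)"
  have M1: "M n 1 = 0" for n
  proof (induction n)
    case (Suc n)
    show ?case using S[of 1 0 1 0 0 0 0 n] Suc by (simp add: algebra_simps)
  qed (simp add: M0)
  have M2: "M n 2 = real n * v" for n
  proof (induction n)
    case (Suc n)
    have "M (Suc n) 2 = v + 0 * M n 1 + 1 * M n 2 + 0 * M n 3 + 0 * M n 4 + 0 * M n 6"
      by (rule S) (simp add: v_def power2_eq_square algebra_simps)
    then show ?case using Suc by (simp add: algebra_simps)
  qed (simp add: M0)
  have M3: "M n 3 = real n * (v * (1 - 2 * p))" for n
  proof (induction n)
    case (Suc n)
    have "M (Suc n) 3 = v * (1 - 2 * p) + 3 * v * M n 1 + 0 * M n 2 + 1 * M n 3 + 0 * M n 4 + 0 * M n 6"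
      by (rule S) (unfold v_def, algebra)
    then show ?case using Suc M1 by (simp add: algebra_simps)
  qed (simp add: M0)
  have M4: "M n 4 = real n * (v * (1 - 3 * v)) + 3 * real n * (real n - 1) * v ^ 2" for n
  proof (induction n)
    case (Suc n)
    have "M (Suc n) 4 = v * (1 - 3 * v) + 4 * (v * (1 - 2 * p)) * M n 1 + 6 * v * M n 2 + 0 * M n 3 + 1 * M n 4 + 0 * M n 6"
      by (rule S) (unfold v_def, algebra)
    then show ?case using Suc M1 M2 by (simp add: algebra_simps power2_eq_square)
  qed (simp add: M0)
  have v: "0 \<le> v" "v \<le> 1" using p unfolding v_def by (auto intro: mult_le_one)
  have M6: "M n 6 \<le> 100 * real n ^ 3" for n
  proof (induction n)
    case (Suc n)
    define k6 where "k6 = p * (1 - p) ^ 6 + (1 - p) * p ^ 6"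
    define k5 where "k5 = p * (1 - p) ^ 5 - (1 - p) * p ^ 5"
    have "M (Suc n) 6 = k6 + 6 * k5 * M n 1 + 15 * (v * (1 - 3 * v)) * M n 2 + 20 * (v * (1 - 2 * p)) * M n 3 + 15 * v * M n 4 + 1 * M n 6"
      by (rule S) (unfold v_def k5_def k6_def, algebra)
    moreover have "k6 \<le> 2"
    proof -
      have "p * (1 - p) ^ 6 \<le> 1" "(1 - p) * p ^ 6 \<le> 1"
        using p by (auto intro!: mult_le_one power_le_one)
      then show ?thesis by (simp add: k6_def)
    qed
    moreover have v2: "0 \<le> v * v" "v * v \<le> 1" using v by (auto intro: mult_le_one)
    have "15 * (v * (1 - 3 * v)) * M n 2 \<le> 15 * real n"
    proof -
      have "v * (1 - 3 * v) * v \<le> 1" 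
        using v2 mult_nonneg_nonneg[OF v(1) v2(1)] by (simp add: algebra_simps)
      then have "real n * (v * (1 - 3 * v) * v) \<le> real n * 1" by (intro mult_left_mono) auto
      then have "15 * (real n * (v * (1 - 3 * v) * v)) \<le> 15 * real n" by simp
      then show ?thesis unfolding M2 by (simp only: mult_ac)
    qed
    moreover have "20 * (v * (1 - 2 * p)) * M n 3 \<le> 20 * real n"
    proof -
      have "(1 - 2 * p) ^ 2 \<le> 1" using p by (auto simp: abs_square_le_1 abs_if)
      then have "(v * v) * (1 - 2 * p) ^ 2 \<le> 1" using mult_le_one[OF v2(2), of "(1 - 2 * p) ^ 2"] by simp
      then have "real n * ((v * v) * (1 - 2 * p) ^ 2) \<le> real n * 1" by (intro mult_left_mono) auto
      then have "20 * (real n * ((v * v) * (1 - 2 * p) ^ 2)) \<le> 20 * real n" by simp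
      then show ?thesis unfolding M3 by (simp only: mult_ac power2_eq_square)
    qed
    moreover have "15 * v * M n 4 \<le> 15 * (real n + 3 * real n ^ 2)"
    proof -
      have "M n 4 \<le> real n + 3 * real n ^ 2"
      proof -
        have "v * (1 - 3 * v) \<le> v * 1" using v by (intro mult_left_mono) auto
        then have "v * (1 - 3 * v) \<le> 1" using v by simp
        then have "real n * (v * (1 - 3 * v)) \<le> real n * 1" by (intro mult_left_mono) auto
        moreover have "3 * real n * (real n - 1) * v ^ 2 \<le> 3 * real n ^ 2"
        proof (cases n)
          case (Suc m)
          have "3 * real n * (real n - 1) * v ^ 2 \<le> 3 * real n * real n * 1"
            using Suc v2 by (intro mult_mono) (auto simp: power2_eq_square)
          then show ?thesis by (simp add: power2_eq_square)
        qed simp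
        ultimately show ?thesis unfolding M4 by linarith
      qed
      moreover have "0 \<le> M n 4" unfolding M_def by (intro Bochner_Integration.integral_nonneg) auto
      ultimately have "v * M n 4 \<le> 1 * (real n + 3 * real n ^ 2)" using v by (intro mult_mono) auto
      then show ?thesis by simp
    qed
    \<comment> \<open>Only the order \<open>n^3\<close> matters. The constant 100 is generous: the
      increment \<open>2 + 50 n + 45 n^2\<close> is below
      \<open>100 * ((n + 1)^3 - n^3)\<close>.\<close>
    ultimately have "M (Suc n) 6 \<le> 2 + 50 * real n + 45 * real n ^ 2 + 100 * real n ^ 3"
      using Suc M1 by simp
    also have "\<dots> \<le> 100 * real (Suc n) ^ 3"
      by (simp add: power3_eq_cube power2_eq_square algebra_simps)
    finally show ?case .
  qed (simp add: M0)
  show "M n 1 = 0" "M n 2 = real n * (p * (1 - p))" "M n 3 = real n * (p * (1 - p) * (1 - 2 * p))"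
    "M n 4 = real n * (p * (1 - p) * (1 - 3 * p * (1 - p))) + 3 * real n * (real n - 1) * (p * (1 - p)) ^ 2"
    "M n 6 \<le> 100 * real n ^ 3"
    using M1 M2 M3 M4 M6 by (simp_all add: v_def mult_ac)
qed

text \<open>With \<open>k / n = p * (1 + u)\<close> the integrand is
  \<open>p * (1 + u) * ln (1 + u)\<close>, and \<open>u\<close> has mean 0. The second moment gives
  \<open>(1 - p) / (2 n)\<close>. At order \<open>1 / n^2\<close> the third moment contributes
  \<open>- (1 - p) * (1 - 2 p) / (6 p)\<close> and the fourth \<open>(1 - p)^2 / (4 p)\<close>,
  which add up to \<open>(1 / p - p) / 12\<close>.\<close>

lemma binomial_x_ln_x_expansion:
  assumes p: "0 < p" "p \<le> 1"
  shows "(\<lambda>n. measure_pmf.expectation (binomial_pmf n p) (\<lambda>k. real k / real n * ln (real k / real n / p))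
      - ((1 - p) / (2 * real n) + (1 / p - p) / (12 * real n ^ 2))) \<in> o(\<lambda>n. 1 / real n ^ 2)"
proof (rule landau_o.smallI)
  fix c :: real assume c: "0 < c"
  have p': "p \<in> {0..1}" using p by simp
  \<comment> \<open>The fourth moment is at most \<open>4 * p * n^2\<close>, so the \<epsilon>-part
    of the remainder has mean at most \<open>4 * \<epsilon> / (p^2 * n^2)\<close>, which is
    \<open>c / (4 n^2)\<close>.\<close>
  define \<epsilon> where "\<epsilon> = c * p ^ 2 / 16"
  have \<epsilon>: "0 < \<epsilon>" using c p by (simp add: \<epsilon>_def)
  from x_ln_x_taylor[OF this] obtain C where C: "0 \<le> C"
    "\<And>u. -1 \<le> u \<Longrightarrow> \<bar>(1 + u) * ln (1 + u) - (u + u ^ 2 / 2 - u ^ 3 / 6 + u ^ 4 / 12)\<bar> \<le> \<epsilon> * u ^ 4 + C * u ^ 6"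
    by blast
  define M where "M n r = measure_pmf.expectation (binomial_pmf n p) (\<lambda>k. (real k - real n * p) ^ r)" for n r
  note M = binomial_central_moments[OF p', folded M_def]
  \<comment> \<open>The first summand is the exact \<open>1 / n^3\<close> part left over by the
    fourth moment; the second comes from the sixth-moment bound.\<close>
  define K where "K = 1 / 4 * \<bar>(1 - p) * (1 - 6 * p * (1 - p)) / (3 * p ^ 2)\<bar> + 100 * C / p ^ 5"
  have est: "\<bar>measure_pmf.expectation (binomial_pmf n p) (\<lambda>k. real k / real n * ln (real k / real n / p))
      - ((1 - p) / (2 * real n) + (1 / p - p) / (12 * real n ^ 2))\<bar> \<le> c / 4 * (1 / real n ^ 2) + K / real n ^ 3"
    if n: "n > 0" for n
  proof -
    define u where "u k = (real k - real n * p) / (real n * p)" for k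
    have Eu: "measure_pmf.expectation (binomial_pmf n p) (\<lambda>k. u k ^ r) = M n r / (real n * p) ^ r" for r
      unfolding u_def M_def by (simp add: power_divide)
    have u: "1 + u k = real k / real n / p" for k using n p by (simp add: u_def field_simps)
    have u1: "-1 \<le> u k" for k
    proof -
      have "0 \<le> 1 + u k" unfolding u using p by simp
      then show ?thesis by simp
    qed
    define T where "T x = x + x ^ 2 / 2 - x ^ 3 / 6 + x ^ 4 / 12" for x :: real
    have ET: "measure_pmf.expectation (binomial_pmf n p) (\<lambda>k. p * T (u k)) =
       p * (M n 1 / (real n * p) + M n 2 / (real n * p) ^ 2 / 2 - M n 3 / (real n * p) ^ 3 / 6 + M n 4 / (real n * p) ^ 4 / 12)"
    proof -
      have "measure_pmf.expectation (binomial_pmf n p) (\<lambda>k. p * T (u k)) =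
        measure_pmf.expectation (binomial_pmf n p) (\<lambda>k. p * (u k ^ 1 + (1 / 2) * u k ^ 2 + (- 1 / 6) * u k ^ 3 + (1 / 12) * u k ^ 4))"
        by (simp add: T_def)
      also have "\<dots> = p * (M n 1 / (real n * p) ^ 1 + (1 / 2) * (M n 2 / (real n * p) ^ 2)
          + (- 1 / 6) * (M n 3 / (real n * p) ^ 3) + (1 / 12) * (M n 4 / (real n * p) ^ 4))"
        using p' by (simp only: Bochner_Integration.integral_add integrable_binomial_pmf integral_mult_right_zero Eu)
      finally show ?thesis by (simp add: mult_ac)
    qed
    have ET': "measure_pmf.expectation (binomial_pmf n p) (\<lambda>k. p * T (u k)) =
        (1 - p) / (2 * real n) + (1 / p - p) / (12 * real n ^ 2)
        + (1 / 4) * ((1 - p) * (1 - 6 * p * (1 - p)) / (3 * p ^ 2)) / real n ^ 3"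
      unfolding ET M using n p by (simp add: divide_simps) algebra
    have "\<bar>measure_pmf.expectation (binomial_pmf n p) (\<lambda>k. real k / real n * ln (real k / real n / p))
        - measure_pmf.expectation (binomial_pmf n p) (\<lambda>k. p * T (u k))\<bar> =
      \<bar>measure_pmf.expectation (binomial_pmf n p) (\<lambda>k. p * ((1 + u k) * ln (1 + u k) - T (u k)))\<bar>"
      using p p' by (simp add: u right_diff_distrib)
    also have "\<dots> \<le> measure_pmf.expectation (binomial_pmf n p) (\<lambda>k. \<bar>p * ((1 + u k) * ln (1 + u k) - T (u k))\<bar>)"
      by (rule integral_abs_bound)
    also have "\<dots> \<le> measure_pmf.expectation (binomial_pmf n p) (\<lambda>k. p * (\<epsilon> * u k ^ 4 + C * u k ^ 6))"
      using p p' C(2)[OF u1] unfolding T_def by (intro integral_mono) (auto simp: abs_mult)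
    also have "\<dots> = p * (\<epsilon> * (M n 4 / (real n * p) ^ 4) + C * (M n 6 / (real n * p) ^ 6))"
      using p' by (simp only: Bochner_Integration.integral_add integrable_binomial_pmf integral_mult_right_zero Eu)
    also have "\<dots> \<le> p * (\<epsilon> * (4 * p * real n ^ 2 / (real n * p) ^ 4) + C * (100 * real n ^ 3 / (real n * p) ^ 6))"
    proof -
      have "M n 4 \<le> 4 * p * real n ^ 2"
      proof -
        have a: "0 \<le> p * (1 - p)" "p * (1 - p) \<le> p" "p * (1 - p) \<le> 1"
          using p mult_le_one[of p "1 - p"] by (auto simp: mult_le_cancel_left1)
        have "w * (1 - 3 * w) \<le> p * 1" if "0 \<le> w" "w \<le> p" for w
        proof -
          have "w * (1 - 3 * w) \<le> w * 1" using that by (intro mult_left_mono) auto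
          with that show ?thesis by simp
        qed
        from this[OF a(1,2)] have "p * (1 - p) * (1 - 3 * p * (1 - p)) \<le> p * 1"
          by (simp only: mult.assoc)
        then have "real n * (p * (1 - p) * (1 - 3 * p * (1 - p))) \<le> real n * p" by (intro mult_left_mono) auto
        also have "\<dots> \<le> real n ^ 2 * p" using n p by (intro mult_right_mono) (auto simp: power2_eq_square)
        finally have 1: "real n * (p * (1 - p) * (1 - 3 * p * (1 - p))) \<le> real n ^ 2 * p" .
        have "(p * (1 - p)) * (p * (1 - p)) \<le> p * 1" using a p by (intro mult_mono) auto
        then have "3 * real n * (real n - 1) * (p * (1 - p)) ^ 2 \<le> 3 * real n * real n * p"
          using n by (intro mult_mono) (auto simp: power2_eq_square)
        moreover have "3 * real n * real n * p = 3 * (real n ^ 2 * p)" by (simp add: power2_eq_square)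
        moreover have "4 * p * real n ^ 2 = real n ^ 2 * p + 3 * (real n ^ 2 * p)" by simp
        ultimately show ?thesis using 1 unfolding M by linarith
      qed
      then show ?thesis
        using p \<epsilon> C M(5)[of n] by (intro mult_left_mono add_mono divide_right_mono) auto
    qed
    also have "\<dots> = c / 4 * (1 / real n ^ 2) + 100 * C / p ^ 5 / real n ^ 3"
      using n p by (simp add: \<epsilon>_def divide_simps) algebra
    finally have "\<bar>measure_pmf.expectation (binomial_pmf n p) (\<lambda>k. real k / real n * ln (real k / real n / p))
        - measure_pmf.expectation (binomial_pmf n p) (\<lambda>k. p * T (u k))\<bar> \<le> c / 4 * (1 / real n ^ 2) + 100 * C / p ^ 5 / real n ^ 3" .
    moreover have "\<bar>(1 / 4) * ((1 - p) * (1 - 6 * p * (1 - p)) / (3 * p ^ 2)) / real n ^ 3\<bar>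
      = 1 / 4 * \<bar>(1 - p) * (1 - 6 * p * (1 - p)) / (3 * p ^ 2)\<bar> / real n ^ 3"
      by (simp add: abs_mult)
    ultimately show ?thesis unfolding ET' K_def add_divide_distrib by linarith
  qed
  have "\<forall>\<^sub>F n in sequentially. K / real n ^ 3 \<le> c / 2 * (1 / real n ^ 2)"
    using c by real_asymp
  with eventually_gt_at_top[of 0]
  show "\<forall>\<^sub>F n in sequentially. norm (measure_pmf.expectation (binomial_pmf n p) (\<lambda>k. real k / real n * ln (real k / real n / p))
      - ((1 - p) / (2 * real n) + (1 / p - p) / (12 * real n ^ 2))) \<le> c * norm (1 / real n ^ 2)"
  proof eventually_elim
    case (elim n)
    have "0 \<le> c * (1 / real n ^ 2)" using c by simp
    then show ?case using est[OF elim(1)] elim(2) by simp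
  qed
qed

section \<open>Risk expansions\<close>

text \<open>The conditioning event involves all rows at once, so under the conditional law the row
  totals are no longer binomial. The comparison is therefore made with an unconditional expectation,
  at a cost proportional to the probability of an empty row.\<close>

lemma two_stage_risk_approximation:
  fixes m :: "nat \<times> nat \<Rightarrow> real"
  assumes J: "\<And>i. i \<in> {1..I} \<Longrightarrow> 1 \<le> J i"
    and m: "m \<in> prob_vectors (cells I J)"
    and m_pos: "\<And>i j. (i, j) \<in> cells I J \<Longrightarrow> 0 < m (i, j)"
    and phat: "\<And>i x. \<lbrakk>i \<in> {1..I}; x \<in> count_vectors {1..J i}; sum x {1..J i} \<noteq> 0\<rbrakk> \<Longrightarrow>
                phat i x \<in> prob_vectors {1..J i}"
  shows "(\<lambda>n. two_stage_risk I J (known_first_stage_estimator J m phat) m n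
      - (\<Sum>i=1..I. row_sum J m i * measure_pmf.expectation (binomial_pmf n (row_sum J m i))
           (\<lambda>k. if k = 0 then 0 else second_stage_risk (J i) (phat i) (cond_probs J m i) k)))
    \<in> o(\<lambda>n. 1 / real n ^ 2)"
proof -
  define \<theta> where "\<theta> i = row_sum J m i" for i
  define p where "p i = cond_probs J m i" for i
  define S where "S = nonempty_rows I J"
  define row :: "nat \<Rightarrow> (nat \<times> nat \<Rightarrow> nat) \<Rightarrow> nat \<Rightarrow> nat" where "row i X j = X (i, j)" for i X j
  define g where "g i x = KL {1..J i} (phat i x) (p i)" for i x
  define Mn where "Mn n = multinomial_pmf n m" for n
  have \<theta>: "0 < \<theta> i" "\<theta> i \<le> 1" if i: "i \<in> {1..I}" for i
  proof -
    show "0 < \<theta> i" unfolding \<theta>_def row_sum_def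
      using J[OF i] i by (intro sum_pos m_pos) (auto simp: cells_def)
    show "\<theta> i \<le> 1" unfolding \<theta>_def using row_sum_le_1[OF m i] .
  qed
  have p_pos: "0 < p i j" if "i \<in> {1..I}" "j \<in> {1..J i}" for i j
    using that \<theta>(1)[OF that(1)] m_pos[of i j] by (auto simp: p_def cond_probs_def cells_def \<theta>_def)
  have p: "p i \<in> prob_vectors {1..J i}" if "i \<in> {1..I}" for i
    using cond_probs_prob_vectors[OF m, of i] \<theta>[OF that] by (simp add: p_def \<theta>_def)
  have fin: "finite (set_pmf (Mn n))" for n
    unfolding Mn_def using finite_set_pmf_multinomial[OF finite_cells m] .
  have int: "integrable (Mn n) f" for n and f :: "_ \<Rightarrow> real"
    using fin by (rule integrable_measure_pmf_finite)
  have supp: "X \<in> count_vectors (cells I J)" if "X \<in> set_pmf (Mn n)" for X n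
    using that set_pmf_multinomial_subset[OF finite_cells m, of n] by (auto simp: Mn_def)
  have row_count: "row i X \<in> count_vectors {1..J i}" if "X \<in> count_vectors (cells I J)" for i X
    using that by (auto simp: row_def count_vectors_def cells_def)
  have sum_row: "row_sum J X i = sum (row i X) {1..J i}" for i and X :: "nat \<times> nat \<Rightarrow> nat"
    by (simp add: row_def row_sum_def)

  define B where "B i = (\<Sum>j\<in>{1..J i}. 1 + \<bar>ln (p i j)\<bar>)" for i
  have B0: "0 \<le> B i" for i unfolding B_def by (intro sum_nonneg) auto
  have gB: "\<bar>g i x\<bar> \<le> B i" if "i \<in> {1..I}" "x \<in> count_vectors {1..J i}" "sum x {1..J i} \<noteq> 0" for i x
    unfolding g_def B_def by (rule abs_KL_le) (use phat[OF that] p_pos that in auto)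
  define BB where "BB = (\<Sum>i=1..I. \<theta> i * B i)"

  define F where "F X = (\<Sum>i=1..I. \<theta> i * g i (row i X))" for X
  \<comment> \<open>On an empty row \<open>phat\<close> is arbitrary and \<open>abs_KL_le\<close>
    gives no bound. \<open>G\<close> puts the loss there to 0, which changes nothing on
    \<open>S\<close> and makes \<open>G\<close> bounded on all count vectors.\<close>
  define G where "G X = (\<Sum>i=1..I. \<theta> i * (if sum (row i X) {1..J i} = 0 then 0 else g i (row i X)))" for X
  have KL: "KL (cells I J) (known_first_stage_estimator J m phat X) m = F X" for X
  proof -
    have est: "known_first_stage_estimator J m phat X (i, j) = \<theta> i * phat i (row i X) j" for i j
      by (simp add: known_first_stage_estimator_def \<theta>_def row_def[abs_def])
    have "\<theta> i * phat i (row i X) j * ln (\<theta> i * phat i (row i X) j / m (i, j)) =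
        \<theta> i * (phat i (row i X) j * ln (phat i (row i X) j / p i j))"
      if "i \<in> {1..I}" "j \<in> {1..J i}" for i j
    proof -
      have "m (i, j) = \<theta> i * p i j"
        using \<theta>(1)[OF that(1)] by (simp add: \<theta>_def p_def cond_probs_def)
      then show ?thesis using \<theta>(1)[OF that(1)] by simp
    qed
    then show ?thesis
      unfolding KL_def sum_cells F_def g_def sum_distrib_left est by (intro sum.cong refl)
  qed
  have FG: "F X = G X" if "X \<in> S" for X
    unfolding F_def G_def
  proof (rule sum.cong)
    fix i assume "i \<in> {1..I}"
    then have "sum (row i X) {1..J i} \<noteq> 0"
      using that by (auto simp: S_def nonempty_rows_def sum_row)
    then show "\<theta> i * g i (row i X) =
        \<theta> i * (if sum (row i X) {1..J i} = 0 then 0 else g i (row i X))" by (simp only: if_False)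
  qed simp
  have GB: "\<bar>G X\<bar> \<le> BB" if "X \<in> count_vectors (cells I J)" for X
    unfolding G_def BB_def
  proof (rule order_trans[OF sum_abs], rule sum_mono)
    fix i assume i: "i \<in> {1..I}"
    show "\<bar>\<theta> i * (if sum (row i X) {1..J i} = 0 then 0 else g i (row i X))\<bar> \<le> \<theta> i * B i"
      using \<theta>(1)[OF i] gB[OF i row_count[OF that]] B0[of i] by (auto simp: abs_mult)
  qed
  have BB: "0 \<le> BB" unfolding BB_def using \<theta> B0 by (intro sum_nonneg mult_nonneg_nonneg) (auto intro: less_imp_le)

  have EG: "measure_pmf.expectation (Mn n) G = (\<Sum>i=1..I. \<theta> i * measure_pmf.expectation (binomial_pmf n (\<theta> i))
      (\<lambda>k. if k = 0 then 0 else second_stage_risk (J i) (phat i) (p i) k))" for n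
  proof -
    have "measure_pmf.expectation (Mn n) G = (\<Sum>i=1..I. \<theta> i * measure_pmf.expectation (Mn n)
        (\<lambda>X. if sum (row i X) {1..J i} = 0 then 0 else g i (row i X)))"
      unfolding G_def using int by (subst Bochner_Integration.integral_sum) auto
    also have "\<dots> = (\<Sum>i=1..I. \<theta> i * measure_pmf.expectation (binomial_pmf n (\<theta> i))
      (\<lambda>k. if k = 0 then 0 else second_stage_risk (J i) (phat i) (p i) k))"
    proof (intro sum.cong refl arg_cong2[of _ _ _ _ "(*)"])
      fix i assume i: "i \<in> {1..I}"
      let ?h = "\<lambda>x. if sum x {1..J i} = 0 then 0 else g i x"
      have \<theta>': "\<theta> i \<in> {0..1}" using \<theta>[OF i] by simp
      have fin_k: "finite (set_pmf (multinomial_pmf k (p i)))" for k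
        by (rule finite_set_pmf_multinomial[OF _ p[OF i]]) simp
      have "measure_pmf.expectation (Mn n) (\<lambda>X. ?h (row i X)) =
          measure_pmf.expectation (map_pmf (row i) (Mn n)) ?h" by simp
      also have "map_pmf (row i) (Mn n) = binomial_pmf n (\<theta> i) \<bind> (\<lambda>k. multinomial_pmf k (p i))"
        using multinomial_row[OF m i, of n] \<theta>(1)[OF i]
        by (simp add: row_def[abs_def] Mn_def \<theta>_def p_def)
      also have "measure_pmf.expectation \<dots> ?h = (\<Sum>k\<in>set_pmf (binomial_pmf n (\<theta> i)).
          pmf (binomial_pmf n (\<theta> i)) k *\<^sub>R measure_pmf.expectation (multinomial_pmf k (p i)) ?h)"
        using \<theta>' fin_k by (intro pmf_expectation_bind) auto
      also have "\<dots> = measure_pmf.expectation (binomial_pmf n (\<theta> i))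
          (\<lambda>k. measure_pmf.expectation (multinomial_pmf k (p i)) ?h)"
        using \<theta>' by (intro integral_measure_pmf[symmetric]) auto
      also have "(\<lambda>k. measure_pmf.expectation (multinomial_pmf k (p i)) ?h) =
          (\<lambda>k. if k = 0 then 0 else second_stage_risk (J i) (phat i) (p i) k)"
      proof
        fix k
        have sk: "sum x {1..J i} = k" if "x \<in> set_pmf (multinomial_pmf k (p i))" for x
          using that set_pmf_multinomial_subset[OF _ p[OF i], of k] by auto
        have "measure_pmf.expectation (multinomial_pmf k (p i)) ?h =
            measure_pmf.expectation (multinomial_pmf k (p i)) (\<lambda>x. if k = 0 then 0 else g i x)"
        proof (rule integral_cong_AE)
          show "AE x in measure_pmf (multinomial_pmf k (p i)). ?h x = (if k = 0 then 0 else g i x)"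
            unfolding AE_measure_pmf_iff by (intro ballI) (simp only: sk)
        qed simp_all
        also have "\<dots> = (if k = 0 then 0 else second_stage_risk (J i) (phat i) (p i) k)"
          by (simp add: second_stage_risk_def g_def)
        finally show "measure_pmf.expectation (multinomial_pmf k (p i)) ?h =
          (if k = 0 then 0 else second_stage_risk (J i) (phat i) (p i) k)" .
      qed
      finally show "measure_pmf.expectation (Mn n) (\<lambda>X. ?h (row i X)) =
        measure_pmf.expectation (binomial_pmf n (\<theta> i))
         (\<lambda>k. if k = 0 then 0 else second_stage_risk (J i) (phat i) (p i) k)" .
    qed
    finally show ?thesis .
  qed
  \<comment> \<open>A union bound: row \<open>i\<close> is empty with probability
    \<open>(1 - \<theta> i) ^ n\<close>.\<close>
  define \<eta> where "\<eta> n = (\<Sum>i=1..I. (1 - \<theta> i) ^ n)" for n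
  have Q: "1 - measure_pmf.prob (Mn n) S \<le> \<eta> n" for n
  proof -
    have "1 - measure_pmf.prob (Mn n) S = measure_pmf.prob (Mn n) (- S)"
      using measure_pmf.prob_compl[of S "Mn n"] by (simp add: Compl_eq_Diff_UNIV)
    also have "- S = (\<Union>i\<in>{1..I}. {X. row_sum J X i = 0})"
      by (auto simp: S_def nonempty_rows_def)
    also have "measure_pmf.prob (Mn n) \<dots> \<le> (\<Sum>i\<in>{1..I}. measure_pmf.prob (Mn n) {X. row_sum J X i = 0})"
      by (intro measure_pmf.finite_measure_subadditive_finite) auto
    also have "\<dots> = \<eta> n" unfolding \<eta>_def
    proof (rule sum.cong)
      fix i assume i: "i \<in> {1..I}"
      let ?A = "Pair i ` {1..J i}"
      have A: "?A \<subseteq> cells I J" using i by (auto simp: cells_def)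
      have sA: "sum f ?A = row_sum J f i" for f :: "nat \<times> nat \<Rightarrow> 'c::comm_monoid_add"
        by (simp add: row_sum_def sum.reindex inj_on_def)
      have "measure_pmf.prob (Mn n) {X. row_sum J X i = 0} = pmf (map_pmf (\<lambda>X. sum X ?A) (Mn n)) 0"
        by (simp only: pmf_map vimage_def sA singleton_iff)
      also have "map_pmf (\<lambda>X. sum X ?A) (Mn n) = binomial_pmf n (\<theta> i)"
        unfolding Mn_def \<theta>_def using multinomial_sum_binomial[OF finite_cells m A, of n] by (simp only: sA)
      finally show "measure_pmf.prob (Mn n) {X. row_sum J X i = 0} = (1 - \<theta> i) ^ n"
        using \<theta>[OF i] by simp
    qed simp
    finally show ?thesis .
  qed
  have \<eta>: "\<eta> \<in> o(\<lambda>n. 1 / real n ^ 2)"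
    unfolding \<eta>_def[abs_def]
  proof (intro big_sum_in_smallo power_smallo_inverse_square)
    fix i assume "i \<in> {1..I}"
    from \<theta>[OF this] show "\<bar>1 - \<theta> i\<bar> < 1" by (simp add: abs_if)
  qed
  have "eventually (\<lambda>n. norm (\<eta> n) \<le> (1 / 2) * norm (1 / real n ^ 2)) sequentially"
    using landau_o.smallD[OF \<eta>, of "1/2"] by simp
  \<comment> \<open>From here on the conditioning event has positive probability, so that the
    conditional law is meaningful.\<close>
  then have "eventually (\<lambda>n. \<eta> n < 1) sequentially"
    using eventually_gt_at_top[of 0]
  proof eventually_elim
    case (elim n)
    have "norm (1 / real n ^ 2) \<le> 1" using elim(2) by simp
    with elim(1) show ?case unfolding real_norm_def by linarith
  qed
  then have bound: "eventually (\<lambda>n. \<bar>two_stage_risk I J (known_first_stage_estimator J m phat) m n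
      - measure_pmf.expectation (Mn n) G\<bar> \<le> 2 * BB * \<eta> n) sequentially"
  proof eventually_elim
    case (elim n)
    let ?Q = "measure_pmf.prob (Mn n) S"
    have Q0: "0 < ?Q" using elim Q[of n] by linarith
    have ne: "set_pmf (Mn n) \<inter> S \<noteq> {}"
      using Q0 measure_Int_set_pmf[of "Mn n" S] by (auto simp: Int_commute)
    define E where "E = measure_pmf.expectation (Mn n) (\<lambda>X. indicator S X * G X)"
    have risk: "two_stage_risk I J (known_first_stage_estimator J m phat) m n = E / ?Q"
    proof -
      have "two_stage_risk I J (known_first_stage_estimator J m phat) m n =
          measure_pmf.expectation (Mn n) (\<lambda>X. indicator S X * F X) / ?Q"
        unfolding two_stage_risk_def KL using expectation_cond_pmf[OF fin ne] by (simp add: Mn_def S_def)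
      also have "(\<lambda>X. indicator S X * F X) = (\<lambda>X. indicator S X * G X)"
        using FG by (auto simp: indicator_def fun_eq_iff)
      finally show ?thesis by (simp add: E_def)
    qed
    \<comment> \<open>The factor \<open>?Q\<close> cancels against the normalising division, so that
      passing from \<open>E\<close> to \<open>E / ?Q\<close> costs at most
      \<open>BB * (1 - ?Q)\<close>, without any lower bound on \<open>?Q\<close> beyond
      positivity.\<close>
    have EQ: "\<bar>E\<bar> \<le> BB * ?Q"
    proof -
      have "\<bar>E\<bar> \<le> measure_pmf.expectation (Mn n) (\<lambda>X. \<bar>indicator S X * G X\<bar>)"
        unfolding E_def by (rule integral_abs_bound)
      also have "\<dots> \<le> measure_pmf.expectation (Mn n) (\<lambda>X. BB * indicator S X)"
        by (intro integral_mono_AE int) (auto simp: AE_measure_pmf_iff indicator_def dest!: supp intro: GB)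
      finally show ?thesis by simp
    qed
    have EG': "\<bar>measure_pmf.expectation (Mn n) G - E\<bar> \<le> BB * (1 - ?Q)"
    proof -
      have "measure_pmf.expectation (Mn n) G - E = measure_pmf.expectation (Mn n) (\<lambda>X. G X - indicator S X * G X)"
        unfolding E_def using int by simp
      also have "\<bar>\<dots>\<bar> \<le> measure_pmf.expectation (Mn n) (\<lambda>X. \<bar>G X - indicator S X * G X\<bar>)"
        by (rule integral_abs_bound)
      also have "\<dots> \<le> measure_pmf.expectation (Mn n) (\<lambda>X. BB * (1 - indicator S X))"
        by (intro integral_mono_AE int) (auto simp: AE_measure_pmf_iff indicator_def dest!: supp intro: GB)
      also have "\<dots> = BB * (1 - ?Q)"
        using int[of n "indicator S"] by simp
      finally show ?thesis .
    qed
    have "\<bar>E / ?Q - E\<bar> = \<bar>E\<bar> * (1 - ?Q) / ?Q"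
    proof -
      have "E / ?Q - E = E * (1 - ?Q) / ?Q" using Q0 by (simp add: field_simps)
      then show ?thesis using Q0 by (simp add: abs_mult)
    qed
    also have "\<dots> \<le> (BB * ?Q) * (1 - ?Q) / ?Q"
      using EQ Q0 by (intro divide_right_mono mult_right_mono) auto
    also have "\<dots> = BB * (1 - ?Q)" using Q0 by simp
    finally have "\<bar>E / ?Q - measure_pmf.expectation (Mn n) G\<bar> \<le> 2 * (BB * (1 - ?Q))" using EG' by linarith
    also have "\<dots> \<le> 2 * (BB * \<eta> n)" using Q[of n] BB by (intro mult_left_mono) auto
    finally show ?case by (simp add: risk)
  qed
  have "(\<lambda>n. two_stage_risk I J (known_first_stage_estimator J m phat) m n
      - measure_pmf.expectation (Mn n) G) \<in> O(\<eta>)"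
  proof (rule bigoI[where c = "2 * BB"])
    show "\<forall>\<^sub>F n in sequentially. norm (two_stage_risk I J (known_first_stage_estimator J m phat) m n
      - measure_pmf.expectation (Mn n) G) \<le> 2 * BB * norm (\<eta> n)"
      using bound
    proof eventually_elim
      case (elim n)
      have "2 * BB * \<eta> n \<le> 2 * BB * norm (\<eta> n)" using BB by (intro mult_left_mono) auto
      with elim show ?case by simp
    qed
  qed
  from landau_o.big_small_trans[OF this \<eta>] show ?thesis
    unfolding EG \<theta>_def p_def .
qed

section \<open>Full second-stage models\<close>

lemma smallo_inverse_square_unique:
  fixes a b :: real
  assumes "(\<lambda>n. a / real n + b / real n ^ 2) \<in> o(\<lambda>n. 1 / real n ^ 2)"
  shows "a = 0" "b = 0"
proof -
  have lim: "(\<lambda>n. (a / real n + b / real n ^ 2) / (1 / real n ^ 2)) \<longlonglongrightarrow> 0"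
    using assms by (rule smalloD_tendsto)
  have ev: "eventually (\<lambda>n. (a / real n + b / real n ^ 2) / (1 / real n ^ 2) = a * real n + b) sequentially"
    using eventually_gt_at_top[of 0] by eventually_elim (simp add: field_simps power2_eq_square)
  have lim': "(\<lambda>n. a * real n + b) \<longlonglongrightarrow> 0"
    using Lim_transform_eventually[OF lim ev] .
  \<comment> \<open>Dividing once more by \<open>n\<close> isolates \<open>a\<close>; with
    \<open>a = 0\<close> the previous limit gives \<open>b\<close>.\<close>
  then have "(\<lambda>n. (a * real n + b) * (1 / real n)) \<longlonglongrightarrow> 0 * 0"
    by (intro tendsto_mult lim_1_over_n)
  moreover have "(\<lambda>n. (a * real n + b) * (1 / real n)) \<longlonglongrightarrow> a"
    by real_asymp
  ultimately show a: "a = 0" by (simp add: LIMSEQ_unique)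
  show "b = 0" using lim' a by (simp add: LIMSEQ_const_iff)
qed

text \<open>The divergence is a sum over categories and each count is binomial, so the dependence
  between counts is irrelevant. The coefficients come from summing \<open>1 - p j\<close> and
  \<open>1 / p j - p j\<close>, using that the \<open>p j\<close> add up to 1.\<close>

lemma full_model_risk_expansion:
  assumes p: "p \<in> prob_vectors {1..Ji}" and p_pos: "\<And>j. j \<in> {1..Ji} \<Longrightarrow> 0 < p j"
    and est: "\<And>x. \<lbrakk>x \<in> count_vectors {1..Ji}; sum x {1..Ji} \<noteq> 0\<rbrakk> \<Longrightarrow>
      est x = (\<lambda>j. real (x j) / real (sum x {1..Ji}))"
  shows "(\<lambda>n. second_stage_risk Ji est p n
      - ((real Ji - 1) / (2 * real n) + ((\<Sum>j=1..Ji. 1 / p j) - 1) / (12 * real n ^ 2))) \<in> o(\<lambda>n. 1 / real n ^ 2)"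
proof -
  have p1: "p j \<le> 1" if "j \<in> {1..Ji}" for j
    using member_le_sum[of j "{1..Ji}" p] p that by (auto simp: prob_vectors_def)
  have risk: "second_stage_risk Ji est p n = (\<Sum>j=1..Ji. measure_pmf.expectation (binomial_pmf n (p j))
      (\<lambda>k. real k / real n * ln (real k / real n / p j)))" if n: "n > 0" for n
  proof -
    have fin: "finite (set_pmf (multinomial_pmf n p))"
      by (rule finite_set_pmf_multinomial[OF _ p]) simp
    have "second_stage_risk Ji est p n = measure_pmf.expectation (multinomial_pmf n p)
       (\<lambda>x. \<Sum>j=1..Ji. real (x j) / real n * ln (real (x j) / real n / p j))"
      unfolding second_stage_risk_def KL_def
    proof (rule integral_cong_AE)
      have "est x = (\<lambda>j. real (x j) / real n)" if "x \<in> set_pmf (multinomial_pmf n p)" for x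
      proof -
        have "x \<in> count_vectors {1..Ji}" "sum x {1..Ji} = n"
          using that set_pmf_multinomial_subset[OF _ p, of n] by auto
        with est[of x] n show ?thesis by (simp only: neq0_conv)
      qed
      then show "AE x in measure_pmf (multinomial_pmf n p). (\<Sum>k\<in>{1..Ji}. est x k * ln (est x k / p k)) =
          (\<Sum>j=1..Ji. real (x j) / real n * ln (real (x j) / real n / p j))"
        by (simp add: AE_measure_pmf_iff)
    qed simp_all
    also have "\<dots> = (\<Sum>j=1..Ji. measure_pmf.expectation (multinomial_pmf n p)
       (\<lambda>x. real (x j) / real n * ln (real (x j) / real n / p j)))"
      using fin by (intro Bochner_Integration.integral_sum integrable_measure_pmf_finite)
    also have "\<dots> = (\<Sum>j=1..Ji. measure_pmf.expectation (binomial_pmf n (p j))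
      (\<lambda>k. real k / real n * ln (real k / real n / p j)))"
    proof (rule sum.cong)
      fix j assume j: "j \<in> {1..Ji}"
      have "map_pmf (\<lambda>x. x j) (multinomial_pmf n p) = binomial_pmf n (p j)"
        using multinomial_sum_binomial[OF _ p, of "{j}" n] j by simp
      from this[symmetric] show "measure_pmf.expectation (multinomial_pmf n p)
          (\<lambda>x. real (x j) / real n * ln (real (x j) / real n / p j)) =
        measure_pmf.expectation (binomial_pmf n (p j))
          (\<lambda>k. real k / real n * ln (real k / real n / p j))" by simp
    qed simp
    finally show ?thesis .
  qed
  have "(\<lambda>n. \<Sum>j=1..Ji. measure_pmf.expectation (binomial_pmf n (p j))
      (\<lambda>k. real k / real n * ln (real k / real n / p j))
      - ((1 - p j) / (2 * real n) + (1 / p j - p j) / (12 * real n ^ 2))) \<in> o(\<lambda>n. 1 / real n ^ 2)"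
    by (intro big_sum_in_smallo binomial_x_ln_x_expansion p_pos p1)
  moreover have "(\<Sum>j=1..Ji. (1 - p j) / (2 * real n) + (1 / p j - p j) / (12 * real n ^ 2)) =
     (real Ji - 1) / (2 * real n) + ((\<Sum>j=1..Ji. 1 / p j) - 1) / (12 * real n ^ 2)" for n
    using p by (simp add: sum.distrib sum_divide_distrib[symmetric] sum_subtractf prob_vectors_def)
  ultimately have "(\<lambda>n. (\<Sum>j=1..Ji. measure_pmf.expectation (binomial_pmf n (p j))
      (\<lambda>k. real k / real n * ln (real k / real n / p j)))
      - ((real Ji - 1) / (2 * real n) + ((\<Sum>j=1..Ji. 1 / p j) - 1) / (12 * real n ^ 2))) \<in> o(\<lambda>n. 1 / real n ^ 2)"
    by (simp only: sum_subtractf)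
  then show ?thesis
    by (rule landau_o.small.ev_eq_trans2[rotated])
       (rule eventually_mono[OF eventually_gt_at_top[of 0]], simp only: risk)
qed

section \<open>Maximum likelihood in the two-stage model\<close>

lemma known_first_stage_estimator_is_mle:
  assumes m: "m \<in> prob_vectors (cells I J)"
    and M: "\<And>i. i \<in> {1..I} \<Longrightarrow> M i \<subseteq> prob_vectors {1..J i}"
    and mle: "\<And>i x. \<lbrakk>i \<in> {1..I}; x \<in> count_vectors {1..J i}; sum x {1..J i} \<noteq> 0\<rbrakk> \<Longrightarrow>
                is_mle {1..J i} (M i) x (phat i x)"
    and X: "X \<in> count_vectors (cells I J)" "X \<in> nonempty_rows I J"
  shows "is_mle (cells I J) (two_stage_model I {row_sum J m} M) X
    (known_first_stage_estimator J m phat X)"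
proof -
  define \<theta> where "\<theta> = row_sum J m"
  define row :: "nat \<Rightarrow> nat \<Rightarrow> nat" where "row i j = X (i, j)" for i j
  have \<theta>0: "0 \<le> \<theta> i" for i
    using m by (auto simp: \<theta>_def row_sum_def prob_vectors_def intro: sum_nonneg)
  \<comment> \<open>The model leaves \<open>q i\<close> unrestricted for \<open>i\<close> outside
    \<open>{1..I}\<close>; the vanishing first-stage weight removes these values.\<close>
  have \<theta>_out: "\<theta> i = 0" if "i \<notin> {1..I}" for i
    using m that by (auto simp: \<theta>_def row_sum_def prob_vectors_def cells_def intro!: sum.neutral)
  have \<theta>_sum: "(\<Sum>i=1..I. \<theta> i) = 1"
    using m by (simp add: \<theta>_def row_sum_def prob_vectors_def sum_cells)
  have model: "(\<lambda>(i, j). \<theta> i * q i j) \<in> prob_vectors (cells I J)"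
    if q: "\<And>i. i \<in> {1..I} \<Longrightarrow> q i \<in> M i" for q
  proof -
    have q': "q i \<in> prob_vectors {1..J i}" if "i \<in> {1..I}" for i using q M that by blast
    have "0 \<le> \<theta> i * q i j" for i j
      using \<theta>0 \<theta>_out[of i] q'[of i] by (cases "i \<in> {1..I}") (auto simp: prob_vectors_def)
    moreover have "\<theta> i * q i j = 0" if "(i, j) \<notin> cells I J" for i j
      using that \<theta>_out[of i] q'[of i] by (cases "i \<in> {1..I}") (auto simp: prob_vectors_def cells_def)
    moreover have "(\<Sum>i=1..I. \<Sum>j=1..J i. \<theta> i * q i j) = 1"
      using q' \<theta>_sum by (simp add: sum_distrib_left[symmetric] prob_vectors_def)
    ultimately show ?thesis by (auto simp: prob_vectors_def sum_cells)
  qed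
  have sub: "two_stage_model I {\<theta>} M \<subseteq> prob_vectors (cells I J)"
    using model by (auto simp: two_stage_model_def)
  have rows: "is_mle {1..J i} (M i) (row i) (phat i (row i))" "row i \<in> count_vectors {1..J i}"
    if "i \<in> {1..I}" for i
  proof -
    show "row i \<in> count_vectors {1..J i}"
      using X(1) by (auto simp: row_def count_vectors_def cells_def)
    moreover have "sum (row i) {1..J i} \<noteq> 0"
      using X(2) that by (auto simp: row_def nonempty_rows_def row_sum_def)
    ultimately show "is_mle {1..J i} (M i) (row i) (phat i (row i))" using mle that by blast
  qed
  have phatM: "phat i (row i) \<in> M i" if "i \<in> {1..I}" for i
    using rows[OF that] by (simp add: is_mle_def)
  have est: "known_first_stage_estimator J m phat X = (\<lambda>(i, j). \<theta> i * phat i (row i) j)"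
    by (simp add: known_first_stage_estimator_def \<theta>_def row_def[abs_def])
  show ?thesis
    unfolding \<theta>_def[symmetric] is_mle_iff[OF finite_cells sub X(1)]
  proof (intro conjI ballI)
    show "known_first_stage_estimator J m phat X \<in> two_stage_model I {\<theta>} M"
      unfolding est two_stage_model_def
      by (rule CollectI, rule exI[of _ \<theta>], rule exI[of _ "\<lambda>i. phat i (row i)"]) (use phatM in auto)
    fix r assume "r \<in> two_stage_model I {\<theta>} M"
    then obtain q where q_mem: "\<forall>i\<in>{1..I}. q i \<in> M i" and r: "r = (\<lambda>(i, j). \<theta> i * q i j)"
      unfolding two_stage_model_def by blast
    have q: "q i \<in> M i" if "i \<in> {1..I}" for i using q_mem that by blast
    \<comment> \<open>The likelihood monomial splits into first-stage powers, common to all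
      competitors because the first stage is known, and one monomial for each row. Each row can be
      maximised on its own since the second-stage parameters vary independently.\<close>
    have fac: "(\<Prod>k\<in>cells I J. (\<lambda>(i, j). \<theta> i * s i j) k ^ X k) =
       (\<Prod>i=1..I. (\<Prod>j=1..J i. \<theta> i ^ row i j) * (\<Prod>j=1..J i. s i j ^ row i j))" for s :: "nat \<Rightarrow> nat \<Rightarrow> real"
      unfolding prod_cells by (simp add: row_def power_mult_distrib prod.distrib)
    show "(\<Prod>k\<in>cells I J. r k ^ X k) \<le> (\<Prod>k\<in>cells I J. known_first_stage_estimator J m phat X k ^ X k)"
      unfolding r est fac
    proof (rule prod_mono)
      fix i assume i: "i \<in> {1..I}"
      have "(\<Prod>j=1..J i. q i j ^ row i j) \<le> (\<Prod>j=1..J i. phat i (row i) j ^ row i j)"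
        using rows[OF i] q[OF i] is_mle_iff[OF _ M[OF i] rows(2)[OF i]] by auto
      moreover have "0 \<le> (\<Prod>j=1..J i. q i j ^ row i j)"
        using q[OF i] M[OF i] by (intro prod_nonneg) (auto simp: prob_vectors_def)
      moreover have "0 \<le> (\<Prod>j=1..J i. \<theta> i ^ row i j)" using \<theta>0 by (intro prod_nonneg) auto
      ultimately show "0 \<le> (\<Prod>j=1..J i. \<theta> i ^ row i j) * (\<Prod>j=1..J i. q i j ^ row i j) \<and>
          (\<Prod>j=1..J i. \<theta> i ^ row i j) * (\<Prod>j=1..J i. q i j ^ row i j)
          \<le> (\<Prod>j=1..J i. \<theta> i ^ row i j) * (\<Prod>j=1..J i. phat i (row i) j ^ row i j)"
        by (auto intro: mult_left_mono)
    qed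
  qed
qed

section \<open>Assembly of the expansions\<close>

theorem theorem3:
  fixes I :: nat and J s :: "nat \<Rightarrow> nat"
    and m :: "nat \<times> nat \<Rightarrow> real"
    and T :: "'t set" and mf :: "'t \<Rightarrow> nat \<Rightarrow> real" and \<tau> :: 't
    and \<Theta> :: "nat \<Rightarrow> (nat \<Rightarrow> real) set" and P :: "nat \<Rightarrow> (nat \<Rightarrow> real) \<Rightarrow> nat \<Rightarrow> real"
    and phat :: "nat \<Rightarrow> (nat \<Rightarrow> nat) \<Rightarrow> nat \<Rightarrow> real"
    and A :: "nat \<Rightarrow> real"
  assumes I: "2 \<le> I"
    and J: "\<And>i. i \<in> {1..I} \<Longrightarrow> 1 \<le> J i"
    and m_prob: "m \<in> prob_vectors (cells I J)"
    and m_pos: "\<And>i j. (i, j) \<in> cells I J \<Longrightarrow> 0 < m (i, j)"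
    \<comment> \<open>full first-stage model with known parameter\<close>
    and first_stage_full: "mf ` T = prob_vectors {1..I}"
    and tau: "\<tau> \<in> T" "mf \<tau> = row_sum J m"
    \<comment> \<open>second-stage models; the parameter space is a subset of $s_i$-dimensional space\<close>
    and Theta: "\<And>i. i \<in> {1..I} \<Longrightarrow> \<Theta> i \<subseteq> ({1..s i} \<rightarrow>\<^sub>E UNIV)"
    and second_stage: "\<And>i. i \<in> {1..I} \<Longrightarrow> P i ` \<Theta> i \<subseteq> prob_vectors {1..J i}"
    and true_in_model: "\<And>i. i \<in> {1..I} \<Longrightarrow> cond_probs J m i \<in> P i ` \<Theta> i"
    and mle: "\<And>i x. \<lbrakk>i \<in> {1..I}; x \<in> count_vectors {1..J i}; sum x {1..J i} \<noteq> 0\<rbrakk> \<Longrightarrow>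
                is_mle {1..J i} (P i ` \<Theta> i) x (phat i x)"
    and expansion: "\<And>i. i \<in> {1..I} \<Longrightarrow>
          (\<lambda>n. second_stage_risk (J i) (phat i) (cond_probs J m i) n
                - (real (s i) / (2 * real n) + 1 / (24 * real n ^ 2) * A i))
            \<in> o(\<lambda>n. 1 / real n ^ 2)"
  shows
    "(\<forall>X \<in> count_vectors (cells I J) \<inter> nonempty_rows I J.
        is_mle (cells I J) (two_stage_model I {mf \<tau>} (\<lambda>i. P i ` \<Theta> i)) X
          (known_first_stage_estimator J m phat X)) \<and>
     (\<lambda>n. two_stage_risk I J (known_first_stage_estimator J m phat) m n
           - (1 / (2 * real n) * (\<Sum>i=1..I. real (s i))
              + 1 / (24 * real n ^ 2) *
                  (\<Sum>i=1..I. inverse (row_sum J m i) *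
                     (A i + 12 * (1 - row_sum J m i) * real (s i)))))
       \<in> o(\<lambda>n. 1 / real n ^ 2) \<and>
     ((\<forall>i\<in>{1..I}. P i ` \<Theta> i = prob_vectors {1..J i}) \<longrightarrow>
        (\<forall>i\<in>{1..I}. s i = J i - 1) \<and>
        (let p' = real I - 1 + (\<Sum>i=1..I. real (s i)) in
         (\<lambda>n. two_stage_risk I J (known_first_stage_estimator J m phat) m n
               - ((p' - (real I - 1)) / (2 * real n)
                  + 1 / (12 * real n ^ 2) *
                      ((\<Sum>i=1..I. \<Sum>j=1..J i. inverse (m (i, j)))
                       + (\<Sum>i=1..I. inverse (row_sum J m i) * (6 * real (J i) - 7))
                       - 6 * (p' + 1 - real I))))
           \<in> o(\<lambda>n. 1 / real n ^ 2)))"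
proof -
  define R where "R = two_stage_risk I J (known_first_stage_estimator J m phat) m"
  define \<theta> where "\<theta> i = row_sum J m i" for i
  have phat: "phat i x \<in> prob_vectors {1..J i}"
    if "i \<in> {1..I}" "x \<in> count_vectors {1..J i}" "sum x {1..J i} \<noteq> 0" for i x
    using mle[OF that] second_stage[OF that(1)] by (auto simp: is_mle_def)
  have \<theta>: "0 < \<theta> i" "\<theta> i \<le> 1" if i: "i \<in> {1..I}" for i
  proof -
    show "0 < \<theta> i" unfolding \<theta>_def row_sum_def
      using J[OF i] i by (intro sum_pos m_pos) (auto simp: cells_def)
    show "\<theta> i \<le> 1" unfolding \<theta>_def using row_sum_le_1[OF m_prob i] .
  qed
  \<comment> \<open>Here \<open>a = s i / 2\<close> and \<open>b = A i / 24\<close>. After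
    multiplication by \<open>\<theta> i\<close>, the term \<open>a * (1 - \<theta> i)\<close>
    becomes \<open>12 * (1 - \<theta> i) * s i\<close> inside the bracket over
    \<open>24 * n^2\<close>. Setting the value at \<open>k = 0\<close> to 0 does not affect the
    asymptotic hypothesis.\<close>
  have exp_i: "(\<lambda>n. measure_pmf.expectation (binomial_pmf n (\<theta> i))
        (\<lambda>k. if k = 0 then 0 else second_stage_risk (J i) (phat i) (cond_probs J m i) k)
      - (real (s i) / 2 / (real n * \<theta> i) + (A i / 24 + real (s i) / 2 * (1 - \<theta> i)) / (real n * \<theta> i) ^ 2))
      \<in> o(\<lambda>n. 1 / real n ^ 2)" if i: "i \<in> {1..I}" for i
  proof (rule binomial_expectation_expansion[OF \<theta>[OF i]])
    show "(\<lambda>k. (if k = 0 then 0 else second_stage_risk (J i) (phat i) (cond_probs J m i) k)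
        - (real (s i) / 2 / real k + A i / 24 / real k ^ 2)) \<in> o(\<lambda>n. 1 / real n ^ 2)"
      using expansion[OF i]
      by (rule landau_o.small.ev_eq_trans2[rotated])
         (rule eventually_mono[OF eventually_gt_at_top[of 0]], simp)
  qed
  have "(\<lambda>n. \<theta> i * (measure_pmf.expectation (binomial_pmf n (\<theta> i))
        (\<lambda>k. if k = 0 then 0 else second_stage_risk (J i) (phat i) (cond_probs J m i) k)
      - (real (s i) / 2 / (real n * \<theta> i) + (A i / 24 + real (s i) / 2 * (1 - \<theta> i)) / (real n * \<theta> i) ^ 2)))
      \<in> o(\<lambda>n. 1 / real n ^ 2)" if i: "i \<in> {1..I}" for i
    using exp_i[OF i] \<theta>[OF i] by (subst landau_o.small.cmult_in_iff) auto
  then have "(\<lambda>n. \<Sum>i=1..I. \<theta> i * (measure_pmf.expectation (binomial_pmf n (\<theta> i))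
        (\<lambda>k. if k = 0 then 0 else second_stage_risk (J i) (phat i) (cond_probs J m i) k)
      - (real (s i) / 2 / (real n * \<theta> i) + (A i / 24 + real (s i) / 2 * (1 - \<theta> i)) / (real n * \<theta> i) ^ 2)))
      \<in> o(\<lambda>n. 1 / real n ^ 2)"
    by (rule big_sum_in_smallo)
  moreover have "(\<lambda>n. R n - (\<Sum>i=1..I. \<theta> i * measure_pmf.expectation (binomial_pmf n (\<theta> i))
        (\<lambda>k. if k = 0 then 0 else second_stage_risk (J i) (phat i) (cond_probs J m i) k)))
      \<in> o(\<lambda>n. 1 / real n ^ 2)"
    unfolding R_def \<theta>_def by (rule two_stage_risk_approximation) (fact J m_prob m_pos phat)+
  ultimately
  have "(\<lambda>n. (R n - (\<Sum>i=1..I. \<theta> i * measure_pmf.expectation (binomial_pmf n (\<theta> i))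
        (\<lambda>k. if k = 0 then 0 else second_stage_risk (J i) (phat i) (cond_probs J m i) k))) +
     (\<Sum>i=1..I. \<theta> i * (measure_pmf.expectation (binomial_pmf n (\<theta> i))
        (\<lambda>k. if k = 0 then 0 else second_stage_risk (J i) (phat i) (cond_probs J m i) k)
      - (real (s i) / 2 / (real n * \<theta> i) + (A i / 24 + real (s i) / 2 * (1 - \<theta> i)) / (real n * \<theta> i) ^ 2))))
    \<in> o(\<lambda>n. 1 / real n ^ 2)"
    by (intro sum_in_smallo(1))
  then have "(\<lambda>n. R n - (\<Sum>i=1..I. \<theta> i * (real (s i) / 2 / (real n * \<theta> i)
        + (A i / 24 + real (s i) / 2 * (1 - \<theta> i)) / (real n * \<theta> i) ^ 2))) \<in> o(\<lambda>n. 1 / real n ^ 2)"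
    by (simp only: right_diff_distrib sum_subtractf diff_add_eq add_diff_eq diff_add_cancel add_diff_cancel_right')
  moreover have "(\<Sum>i=1..I. \<theta> i * (real (s i) / 2 / (real n * \<theta> i)
        + (A i / 24 + real (s i) / 2 * (1 - \<theta> i)) / (real n * \<theta> i) ^ 2)) =
      1 / (2 * real n) * (\<Sum>i=1..I. real (s i)) + 1 / (24 * real n ^ 2) *
        (\<Sum>i=1..I. inverse (\<theta> i) * (A i + 12 * (1 - \<theta> i) * real (s i)))" for n
    unfolding sum_distrib_left sum.distrib[symmetric]
  proof (rule sum.cong)
    fix i assume i: "i \<in> {1..I}"
    show "\<theta> i * (real (s i) / 2 / (real n * \<theta> i)
        + (A i / 24 + real (s i) / 2 * (1 - \<theta> i)) / (real n * \<theta> i) ^ 2) =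
      1 / (2 * real n) * real (s i) + 1 / (24 * real n ^ 2) * (inverse (\<theta> i) * (A i + 12 * (1 - \<theta> i) * real (s i)))"
      using \<theta>(1)[OF i] by (cases "n = 0") (auto simp: field_simps power2_eq_square)
  qed simp
  ultimately have main: "(\<lambda>n. R n - (1 / (2 * real n) * (\<Sum>i=1..I. real (s i)) + 1 / (24 * real n ^ 2) *
        (\<Sum>i=1..I. inverse (\<theta> i) * (A i + 12 * (1 - \<theta> i) * real (s i))))) \<in> o(\<lambda>n. 1 / real n ^ 2)"
    by simp

  \<comment> \<open>The factor 2 is 24 / 12, the ratio of the two normalisations of the second-order
    term. Since \<open>J i \<ge> 1\<close>, the truncated subtraction agrees with the real
    one.\<close>
  have full: "s i = J i - 1 \<and> A i = 2 * ((\<Sum>j=1..J i. 1 / cond_probs J m i j) - 1)"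
    if i: "i \<in> {1..I}" and F: "P i ` \<Theta> i = prob_vectors {1..J i}" for i
  proof -
    let ?p = "cond_probs J m i"
    have p: "?p \<in> prob_vectors {1..J i}" using true_in_model[OF i] F by simp
    have p_pos: "0 < ?p j" if "j \<in> {1..J i}" for j
      using that i \<theta>(1)[OF i] m_pos[of i j] by (auto simp: cond_probs_def cells_def \<theta>_def)
    have est: "phat i x = (\<lambda>j. real (x j) / real (sum x {1..J i}))"
      if "x \<in> count_vectors {1..J i}" "sum x {1..J i} \<noteq> 0" for x
      using is_mle_full_model[OF _ that, of "phat i x"] mle[OF i that] F by simp
    have cancel_sub: "r - a + b - r = b - a" for r a b :: real by simp
    let ?b = "((\<Sum>j=1..J i. 1 / ?p j) - 1)"
    have "(\<lambda>n. second_stage_risk (J i) (phat i) ?p n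
        - ((real (J i) - 1) / (2 * real n) + ?b / (12 * real n ^ 2))) \<in> o(\<lambda>n. 1 / real n ^ 2)"
      by (rule full_model_risk_expansion) (fact p p_pos est)+
    from sum_in_smallo(2)[OF this expansion[OF i]]
    have "(\<lambda>n. (real (s i) / (2 * real n) + 1 / (24 * real n ^ 2) * A i)
        - ((real (J i) - 1) / (2 * real n) + ?b / (12 * real n ^ 2))) \<in> o(\<lambda>n. 1 / real n ^ 2)"
      unfolding diff_diff_eq2 by (simp only: cancel_sub)
    moreover have "(real (s i) / (2 * real n) + 1 / (24 * real n ^ 2) * A i)
        - ((real (J i) - 1) / (2 * real n) + ?b / (12 * real n ^ 2)) =
      (real (s i) - (real (J i) - 1)) / 2 / real n + (A i / 24 - ?b / 12) / real n ^ 2" for n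
      by (simp add: diff_divide_distrib add_divide_distrib)
    ultimately have "(\<lambda>n. (real (s i) - (real (J i) - 1)) / 2 / real n + (A i / 24 - ?b / 12) / real n ^ 2)
        \<in> o(\<lambda>n. 1 / real n ^ 2)" by (simp only:)
    from smallo_inverse_square_unique[OF this] show ?thesis using J[OF i] by auto
  qed

  show ?thesis
  proof (intro conjI impI ballI)
    fix X assume "X \<in> count_vectors (cells I J) \<inter> nonempty_rows I J"
    then show "is_mle (cells I J) (two_stage_model I {mf \<tau>} (\<lambda>i. P i ` \<Theta> i)) X
        (known_first_stage_estimator J m phat X)"
      unfolding tau(2)
      using known_first_stage_estimator_is_mle[OF m_prob second_stage mle] by blast
  next
    show "(\<lambda>n. two_stage_risk I J (known_first_stage_estimator J m phat) m n
           - (1 / (2 * real n) * (\<Sum>i=1..I. real (s i))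
              + 1 / (24 * real n ^ 2) *
                  (\<Sum>i=1..I. inverse (row_sum J m i) *
                     (A i + 12 * (1 - row_sum J m i) * real (s i)))))
       \<in> o(\<lambda>n. 1 / real n ^ 2)"
      using main unfolding R_def \<theta>_def .
  next
    fix i assume "\<forall>i\<in>{1..I}. P i ` \<Theta> i = prob_vectors {1..J i}" "i \<in> {1..I}"
    then show "s i = J i - 1" using full by blast
  next
    assume F: "\<forall>i\<in>{1..I}. P i ` \<Theta> i = prob_vectors {1..J i}"
    define p' where "p' = real I - 1 + (\<Sum>i=1..I. real (s i))"
    \<comment> \<open>After halving, \<open>6 * J i - 7\<close> collects -1 from \<open>A i\<close>
      and \<open>6 * (J i - 1)\<close> from the random row total. The rest,
      \<open>- 6 * s i\<close>, sums to \<open>- 6 * (p' + 1 - I)\<close>.\<close>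
    have "(\<Sum>i=1..I. inverse (\<theta> i) * (A i + 12 * (1 - \<theta> i) * real (s i))) =
      (\<Sum>i=1..I. 2 * ((\<Sum>j=1..J i. inverse (m (i, j))) + inverse (\<theta> i) * (6 * real (J i) - 7) - 6 * real (s i)))"
    proof (rule sum.cong)
      fix i assume i: "i \<in> {1..I}"
      have s: "real (s i) = real (J i) - 1" using full[OF i] F i J[OF i] by auto
      have "(\<Sum>j=1..J i. 1 / cond_probs J m i j) = \<theta> i * (\<Sum>j=1..J i. inverse (m (i, j)))"
        unfolding sum_distrib_left by (rule sum.cong) (auto simp: cond_probs_def \<theta>_def divide_inverse)
      then have A: "A i = 2 * (\<theta> i * (\<Sum>j=1..J i. inverse (m (i, j))) - 1)" using full[OF i] F i by simp
      show "inverse (\<theta> i) * (A i + 12 * (1 - \<theta> i) * real (s i)) =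
          2 * ((\<Sum>j=1..J i. inverse (m (i, j))) + inverse (\<theta> i) * (6 * real (J i) - 7) - 6 * real (s i))"
        unfolding A s using \<theta>(1)[OF i] by (simp add: field_simps)
    qed simp
    also have "\<dots> = 2 * ((\<Sum>i=1..I. \<Sum>j=1..J i. inverse (m (i, j)))
        + (\<Sum>i=1..I. inverse (\<theta> i) * (6 * real (J i) - 7)) - 6 * (p' + 1 - real I))"
      by (simp add: sum_distrib_left[symmetric] sum.distrib sum_subtractf p'_def)
    finally have E: "(\<Sum>i=1..I. inverse (\<theta> i) * (A i + 12 * (1 - \<theta> i) * real (s i))) =
      2 * ((\<Sum>i=1..I. \<Sum>j=1..J i. inverse (m (i, j)))
        + (\<Sum>i=1..I. inverse (\<theta> i) * (6 * real (J i) - 7)) - 6 * (p' + 1 - real I))" .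
    have "1 / (2 * real n) * (\<Sum>i=1..I. real (s i)) + 1 / (24 * real n ^ 2) * (2 * Z) =
        (p' - (real I - 1)) / (2 * real n) + 1 / (12 * real n ^ 2) * Z" for n Z
      by (simp add: p'_def)
    then have "(\<lambda>n. R n - ((p' - (real I - 1)) / (2 * real n) + 1 / (12 * real n ^ 2) *
          ((\<Sum>i=1..I. \<Sum>j=1..J i. inverse (m (i, j)))
           + (\<Sum>i=1..I. inverse (\<theta> i) * (6 * real (J i) - 7)) - 6 * (p' + 1 - real I))))
        \<in> o(\<lambda>n. 1 / real n ^ 2)"
      using main unfolding E by (simp only:)
    then show "let p' = real I - 1 + (\<Sum>i=1..I. real (s i)) in
         (\<lambda>n. two_stage_risk I J (known_first_stage_estimator J m phat) m n
               - ((p' - (real I - 1)) / (2 * real n)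
                  + 1 / (12 * real n ^ 2) *
                      ((\<Sum>i=1..I. \<Sum>j=1..J i. inverse (m (i, j)))
                       + (\<Sum>i=1..I. inverse (row_sum J m i) * (6 * real (J i) - 7))
                       - 6 * (p' + 1 - real I))))
           \<in> o(\<lambda>n. 1 / real n ^ 2)"
      unfolding Let_def p'_def R_def \<theta>_def .
  qed
qed

end
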